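(* Suppose $\min\{d_1,\dots,d_{L-1}\}\ge \min\{d_0,d_L\}$. Then $\bm W=(\bm W_1,\dots,\bm W_L)\in\mathcal W_F$ if and only if there exist $\bm Q_l\in\mathcal O^{d_{l-1}}$ for $l=2,\dots,L$, $\bm O_i\in\mathcal O^{h_i}$ for $i\in[p_Y]$, $\bm O_{p_Y+1}\in\mathcal O^{d_0-r_Y}$, $\widehat{\bm O}_{p_Y+1}\in\mathcal O^{d_L-r_Y}$, and a vector $\bm\sigma\in\mathbb R^{r_Y}$ satisfying $$\sigma_i^{2L-1}-\sqrt{\lambda}\,y_i\,\sigma_i^{L-1}+\lambda\sigma_i=0,\quad \sigma_i\ge 0,\quad \forall i\in[r_Y],\qquad \lambda:=\prod_{l=1}^L\lambda_l,$$ such that, with $\bm\Sigma_l\in\mathbb R^{d_l\times d_{l-1}}$ the matrix whose top-left $r_Y\times r_Y$ block is $\mathrm{diag}(\bm\sigma)/\sqrt{\lambda_l}$ and all other entries zero ($l\in[L]$), $$\bm W_1=\bm Q_2\bm\Sigma_1\,\mathrm{BlkD}(\bm O_1,\dots,\bm O_{p_Y},\bm O_{p_Y+1})\,\bm V_Y^T,\qquad \bm W_l=\bm Q_{l+1}\bm\Sigma_l\bm Q_l^T\ (l=2,\dots,L-1),$$ $$\bm W_L=\bm U_Y\,\mathrm{BlkD}(\bm O_1^T,\dots,\bm O_{p_Y}^T,\widehat{\bm O}_{p_Y+1}^T)\,\bm\Sigma_L\bm Q_L^T.$$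
   Context: Let $L\ge2$ be an integer, $d_0,\dots,d_L$ positive integers, $\bm Y\in\mathbb R^{d_L\times d_0}$, and $\lambda_1,\dots,\lambda_L>0$. For $\bm W=(\bm W_1,\dots,\bm W_L)$ with $\bm W_l\in\mathbb R^{d_l\times d_{l-1}}$, define $F(\bm W)=\|\bm W_L\cdots\bm W_1-\bm Y\|_F^2+\sum_{l=1}^L\lambda_l\|\bm W_l\|_F^2$ and $\mathcal W_F=\{\bm W:\nabla F(\bm W)=\bm 0\}$. Let $d_{\min}=\min\{d_0,d_L\}$ and let $\bm Y=\bm U_Y\bm\Sigma_Y\bm V_Y^T$ be an SVD with $\bm U_Y\in\mathcal O^{d_L}$, $\bm V_Y\in\mathcal O^{d_0}$, and $\bm\Sigma_Y\in\mathbb R^{d_L\times d_0}$ having diagonal entries $y_1\ge\dots\ge y_{d_{\min}}\ge0$ and zeros elsewhere. Let $r_Y=\mathrm{rank}(\bm Y)$, let $p_Y$ be the number of distinct positive singular values, and let $0=s_0<s_1<\dots<s_{p_Y}=r_Y$ be indices with $y_{s_{k-1}+1}=\dots=y_{s_k}$ and $y_{s_k}>y_{s_k+1}$ for each $k\in[p_Y]$ (with $y_j=0$ for $j>r_Y$); $h_k=s_k-s_{k-1}$. $\mathcal O^{n}$ denotes the set of $n\times n$ orthogonal matrices and $\mathrm{BlkD}(\cdot)$ a block-diagonal matrix with the listed diagonal blocks. *)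

theory Defs
  imports "HOL-Analysis.Analysis" "Jordan_Normal_Form.DL_Rank"
begin

definition orth_mat :: "nat \<Rightarrow> real mat \<Rightarrow> bool" where
  "orth_mat n Q \<longleftrightarrow> Q \<in> carrier_mat n n \<and> Q * transpose_mat Q = 1\<^sub>m n"

definition frob2 :: "real mat \<Rightarrow> real" where
  "frob2 A = (\<Sum>i<dim_row A. \<Sum>j<dim_col A. (A $$ (i,j))^2)"

fun chain :: "(nat \<Rightarrow> nat) \<Rightarrow> (nat \<Rightarrow> real mat) \<Rightarrow> nat \<Rightarrow> real mat" where
  "chain d W 0 = 1\<^sub>m (d 0)"
| "chain d W (Suc l) = W (Suc l) * chain d W l"

definition lossF :: "nat \<Rightarrow> (nat \<Rightarrow> nat) \<Rightarrow> real mat \<Rightarrow> (nat \<Rightarrow> real) \<Rightarrow> (nat \<Rightarrow> real mat) \<Rightarrow> real" where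
  "lossF L d Y lam W = frob2 (chain d W L - Y) + (\<Sum>l\<in>{1..L}. lam l * frob2 (W l))"

text \<open>W is a critical point of F (gradient zero): every directional derivative
  of the polynomial F at W vanishes.\<close>
definition critical :: "nat \<Rightarrow> (nat \<Rightarrow> nat) \<Rightarrow> real mat \<Rightarrow> (nat \<Rightarrow> real) \<Rightarrow> (nat \<Rightarrow> real mat) \<Rightarrow> bool" where
  "critical L d Y lam W \<longleftrightarrow>
     (\<forall>D. (\<forall>l\<in>{1..L}. D l \<in> carrier_mat (d l) (d (l - 1))) \<longrightarrow>
        ((\<lambda>t. lossF L d Y lam (\<lambda>l. W l + t \<cdot>\<^sub>m D l)) has_real_derivative 0) (at 0))"

definition sv :: "real mat \<Rightarrow> nat \<Rightarrow> real" where
  "sv S j = (if 1 \<le> j \<and> j \<le> min (dim_row S) (dim_col S) then S $$ (j - 1, j - 1) else 0)"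

fun blkD :: "real mat list \<Rightarrow> real mat" where
  "blkD [] = 0\<^sub>m 0 0"
| "blkD (A # As) = (let B = blkD As in
     four_block_mat A (0\<^sub>m (dim_row A) (dim_col B)) (0\<^sub>m (dim_row B) (dim_col A)) B)"

definition sigmat :: "nat \<Rightarrow> nat \<Rightarrow> nat \<Rightarrow> (nat \<Rightarrow> real) \<Rightarrow> real \<Rightarrow> real mat" where
  "sigmat dr dc r \<sigma> c = mat dr dc (\<lambda>(i,j). if i = j \<and> i < r then \<sigma> (i + 1) / c else 0)"

end

theory Submission
  imports Defs "Jordan_Normal_Form.Spectral_Radius"
begin

text \<open>Let \<open>C = W\<^sub>L \<cdots> W\<^sub>1\<close>. At a critical point,
  \<open>\<lambda>\<^sub>l\<^sub>+\<^sub>1 W\<^sub>l\<^sub>+\<^sub>1\<^sup>T W\<^sub>l\<^sub>+\<^sub>1 = \<lambda>\<^sub>l W\<^sub>l W\<^sub>l\<^sup>T\<close>, and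
  \<open>C\<^sup>T Y = \<lambda>\<^sub>1 W\<^sub>1\<^sup>T W\<^sub>1 + C\<^sup>T C\<close> and \<open>Y C\<^sup>T\<close> are both symmetric. Hence
  \<open>N = \<lambda>\<^sub>1 W\<^sub>1\<^sup>T W\<^sub>1\<close> commutes with \<open>Y\<^sup>T Y\<close> and vanishes on its kernel, so in the basis \<open>V\<^sub>Y\<close> it is
  diagonalized to \<open>diag(\<sigma>\<^sup>2)\<close> by a block-diagonal orthogonal matrix adapted to the blocks of equal singular
  values. The columns of the rotated \<open>W\<^sub>1\<close> are then orthogonal with norms proportional to \<open>\<sigma>\<^sub>i\<close>, which
  yields \<open>Q\<^sub>2\<close> by completing them to an orthonormal basis, and balancedness propagates this property
  to give \<open>Q\<^sub>3, \<dots>, Q\<^sub>L\<close>. The gradient equation of the last layer finally determines \<open>W\<^sub>L\<close> and forces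
  the polynomial equation for \<open>\<sigma>\<close>; both last diagonal blocks can be taken to be the identity.
  Conversely, all matrices in the factorized form are diagonal in the same bases, where the gradient is
  computed entrywise.\<close>

section \<open>Real matrices and orthogonal completion\<close>

text \<open>Balancedness makes the scaled layers \<open>sqrt (lam l) * W l\<close> share their
  nonzero singular values. This is why one vector \<open>\<sigma>\<close>, divided by
  \<open>sqrt (lam l)\<close>, serves every layer, and why the square root of the product of all
  weights enters its equation. The rotations \<open>Ob i\<close> cannot be avoided: inside an
  eigenspace of \<open>Y^T Y\<close> commutation with \<open>Y^T Y\<close> says nothing about
  \<open>N\<close>, so a basis must be chosen there. A rotation that mixes only equal singular
  values can be moved through the diagonal factor of \<open>Y\<close> to its other side, hence the
  transposed blocks next to \<open>UY\<close>. Where the singular value is 0 the two sides decouple,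
  so the two last blocks are independent and may differ in size. Completion to an orthonormal basis
  is available only for the interior bases. The left basis of the last layer is prescribed by
  \<open>Y\<close>. That layer comes from a linear equation instead: with \<open>D\<close> the
  product of the earlier layers, \<open>lam L W_L + W_L D D^T = Y D^T\<close> is diagonal in the
  bases already found, with positive coefficients \<open>lam L + t_i^2\<close>. Comparing its
  solution with the Gram matrix supplied by balancedness gives the equation for
  \<open>\<sigma>\<close>.\<close>

lemma mat_mult_entry:
  assumes "i < dim_row A" "j < dim_col B" "dim_col A = dim_row B"
  shows "(A * B) $$ (i,j) = (\<Sum>k<dim_row B. A $$ (i,k) * B $$ (k,j))"
  using assms by (simp add: scalar_prod_def lessThan_atLeast0)

text \<open>Entries of products are to be expanded only on demand and as explicit sums, by
  \<open>mat_mult_entry\<close>, not as scalar products of rows and columns.\<close>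

declare index_mult_mat(1) [simp del]

text \<open>Like the laws that follow, stated with dimension equations in place of carrier sets: as
  a rewrite rule it leaves no inner dimension to be guessed. Products are normalized by nesting to
  the right.\<close>

lemma mat_assoc:
  fixes A B C :: "real mat"
  assumes "dim_col A = dim_row B" "dim_col B = dim_row C"
  shows "A * B * C = A * (B * C)"
  by (rule assoc_mult_mat[of A "dim_row A" "dim_row B" B "dim_row C" C "dim_col C"])
    (use assms in \<open>auto intro: carrier_matI\<close>)

lemma mat_transpose_mult:
  fixes A B :: "real mat"
  assumes "dim_col A = dim_row B"
  shows "transpose_mat (A * B) = transpose_mat B * transpose_mat A"
  by (rule transpose_mult[of A "dim_row A" "dim_row B" B "dim_col B"])
    (use assms in \<open>auto intro: carrier_matI\<close>)

lemma mat_mult_smult: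
  fixes A B :: "real mat"
  assumes "dim_col A = dim_row B"
  shows "A * (c \<cdot>\<^sub>m B) = c \<cdot>\<^sub>m (A * B)"
  using assms by (intro eq_matI) (auto simp: mat_mult_entry sum_distrib_left algebra_simps)

lemma mat_smult_mult:
  fixes A B :: "real mat"
  assumes "dim_col A = dim_row B"
  shows "(c \<cdot>\<^sub>m A) * B = c \<cdot>\<^sub>m (A * B)"
  using assms by (intro eq_matI) (auto simp: mat_mult_entry sum_distrib_left algebra_simps)

lemma mat_transpose_smult: "transpose_mat (c \<cdot>\<^sub>m A) = c \<cdot>\<^sub>m transpose_mat A"
  by (intro eq_matI) auto

lemma mat_mult_minus:
  fixes A B C :: "real mat"
  assumes "dim_col A = dim_row B" "dim_row C = dim_row B" "dim_col C = dim_col B"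
  shows "A * (B - C) = A * B - A * C"
  using assms by (intro eq_matI) (auto simp: mat_mult_entry sum_subtractf algebra_simps)

lemma mat_minus_mult:
  fixes A B C :: "real mat"
  assumes "dim_col A = dim_row C" "dim_row A = dim_row B" "dim_col A = dim_col B"
  shows "(A - B) * C = A * C - B * C"
  using assms by (intro eq_matI) (auto simp: mat_mult_entry sum_subtractf algebra_simps)

lemma mat_smult_smult: "a \<cdot>\<^sub>m (b \<cdot>\<^sub>m A) = (a * b) \<cdot>\<^sub>m (A :: real mat)"
  by (intro eq_matI) auto

lemma mat_one_smult: "1 \<cdot>\<^sub>m A = (A :: real mat)"
  by (intro eq_matI) auto

section \<open>Orthogonal matrices\<close>

lemma orth_matD:
  assumes "orth_mat n Q"
  shows "Q \<in> carrier_mat n n" "dim_row Q = n" "dim_col Q = n"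
    "Q * transpose_mat Q = 1\<^sub>m n" "transpose_mat Q * Q = 1\<^sub>m n"
proof -
  show c: "Q \<in> carrier_mat n n" and e: "Q * transpose_mat Q = 1\<^sub>m n"
    using assms by (auto simp: orth_mat_def)
  show "dim_row Q = n" "dim_col Q = n" using c by auto
  show "transpose_mat Q * Q = 1\<^sub>m n"
    using mat_mult_left_right_inverse[OF c _ e] c by auto
qed

text \<open>The trailing factor \<open>B\<close> is needed because in right-nested products
  \<open>Q\<close> and its transpose are never bracketed together.\<close>

lemma orth_mat_cancel:
  assumes "orth_mat n Q" "dim_row B = n"
  shows "Q * (transpose_mat Q * B) = B" "transpose_mat Q * (Q * B) = B"
proof -
  note Q = orth_matD[OF assms(1)]
  have B: "B \<in> carrier_mat n (dim_col B)" using assms(2) by auto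
  have "Q * (transpose_mat Q * B) = Q * transpose_mat Q * B"
    by (rule assoc_mult_mat[symmetric, OF Q(1) _ B]) (use Q(1) in simp)
  also have "\<dots> = B" using B by (simp add: Q(4))
  finally show "Q * (transpose_mat Q * B) = B" .
  have "transpose_mat Q * (Q * B) = transpose_mat Q * Q * B"
    by (rule assoc_mult_mat[symmetric, OF _ Q(1) B]) (use Q(1) in simp)
  also have "\<dots> = B" using B by (simp add: Q(5))
  finally show "transpose_mat Q * (Q * B) = B" .
qed

lemma orth_mat_transpose:
  assumes "orth_mat n Q"
  shows "orth_mat n (transpose_mat Q)"
  unfolding orth_mat_def using orth_matD(1,5)[OF assms] by simp

lemma orth_mat_one: "orth_mat n (1\<^sub>m n)"
  by (simp add: orth_mat_def)

lemma orth_mat_mult: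
  assumes P: "orth_mat n P" and Q: "orth_mat n Q"
  shows "orth_mat n (P * Q)"
proof -
  have "P * Q * transpose_mat (P * Q) = P * (Q * (transpose_mat Q * transpose_mat P))"
    using orth_matD(2,3)[OF P] orth_matD(2,3)[OF Q] by (simp add: mat_transpose_mult mat_assoc)
  also have "\<dots> = 1\<^sub>m n"
    using orth_matD[OF P] by (simp add: orth_mat_cancel[OF Q])
  finally show ?thesis
    using orth_matD(1)[OF P] orth_matD(1)[OF Q] by (auto simp: orth_mat_def)
qed

text \<open>The diagonal is a function on all of \<open>nat\<close>, so that layers of different
  shapes can share it; values outside the shape are ignored.\<close>

definition diag_rect :: "nat \<Rightarrow> nat \<Rightarrow> (nat \<Rightarrow> real) \<Rightarrow> real mat" where
  "diag_rect m n f = mat m n (\<lambda>(i,j). if i = j then f i else 0)"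

lemma diag_rect_dim [simp]: "dim_row (diag_rect m n f) = m" "dim_col (diag_rect m n f) = n"
  by (simp_all add: diag_rect_def)

lemma diag_rect_entry [simp]:
  "i < m \<Longrightarrow> j < n \<Longrightarrow> diag_rect m n f $$ (i,j) = (if i = j then f i else 0)"
  by (simp add: diag_rect_def)

lemma diag_rect_mult_entry:
  assumes "i < m" "j < dim_col B" "dim_row B = n"
  shows "(diag_rect m n f * B) $$ (i,j) = (if i < n then f i * B $$ (i,j) else 0)"
  using assms by (simp add: mat_mult_entry if_distrib[of "\<lambda>x. x * _"] cong: if_cong)

lemma mult_diag_rect_entry:
  assumes "j < n" "i < dim_row A" "dim_col A = m"
  shows "(A * diag_rect m n f) $$ (i,j) = (if j < m then A $$ (i,j) * f j else 0)"
  using assms by (simp add: mat_mult_entry if_distrib[of "\<lambda>x. _ * x"] cong: if_cong)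

text \<open>When the inner dimension \<open>n\<close> is the smallest, the product loses the
  diagonal entries from \<open>n\<close> on; the hypothesis says that they are zero anyway.\<close>

lemma diag_rect_mult:
  assumes "\<And>i. n \<le> i \<Longrightarrow> i < m \<Longrightarrow> i < k \<Longrightarrow> f i * g i = 0"
  shows "diag_rect m n f * diag_rect n k g = diag_rect m k (\<lambda>i. f i * g i)"
  using assms by (intro eq_matI) (auto simp: diag_rect_mult_entry)

lemma transpose_diag_rect: "transpose_mat (diag_rect m n f) = diag_rect n m f"
  by (intro eq_matI) auto

lemma smult_diag_rect: "c \<cdot>\<^sub>m diag_rect m n f = diag_rect m n (\<lambda>i. c * f i)"
  by (intro eq_matI) auto

lemma diag_rect_cong: "(\<And>i. i < m \<Longrightarrow> i < n \<Longrightarrow> f i = g i) \<Longrightarrow> diag_rect m n f = diag_rect m n g"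
  by (intro eq_matI) auto

text \<open>Put the vectors \<open>q i\<close> with \<open>i \<in> S\<close> into the rows of an n x
  n matrix. Row \<open>a\<close> is zero, so the matrix is singular, and a normalized kernel vector
  is orthogonal to all of them.\<close>

lemma exists_orthogonal_vector:
  fixes q :: "nat \<Rightarrow> nat \<Rightarrow> real"
  assumes "a < n" "a \<notin> S"
  shows "\<exists>v. (\<Sum>k<n. v k * v k) = 1 \<and> (\<forall>i\<in>S \<inter> {..<n}. (\<Sum>k<n. q i k * v k) = 0)"
proof -
  define A where "A = mat n n (\<lambda>(i,k). if i \<in> S then q i k else 0)"
  have A: "A \<in> carrier_mat n n" by (simp add: A_def)
  have A_row: "A = mat\<^sub>r n n (\<lambda>i. if i = a then 0\<^sub>v n else row A i)"
    using assms by (intro eq_matI) (auto simp: A_def)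
  have "det A = 0"
    by (subst A_row, rule det_row_0[OF assms(1)]) (use A in auto)
  then obtain v where v: "v \<in> carrier_vec n" "v \<noteq> 0\<^sub>v n" "A *\<^sub>v v = 0\<^sub>v n"
    using det_0_iff_vec_prod_zero_field[OF A] by blast
  define c where "c = (\<Sum>k<n. vec_index v k * vec_index v k)"
  obtain b where b: "b < n" "vec_index v b \<noteq> 0" using v by (metis carrier_vecD eq_vecI index_zero_vec)
  have "0 < vec_index v b * vec_index v b" using b(2) by (auto simp: zero_less_mult_iff linorder_neq_iff)
  also have "\<dots> \<le> c" unfolding c_def
    by (rule member_le_sum[of b "{..<n}" "\<lambda>k. vec_index v k * vec_index v k"]) (use b in auto)
  finally have c: "c > 0" .
  have "(\<Sum>k<n. q i k * vec_index v k) = 0" if "i \<in> S" "i < n" for i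
  proof -
    have "vec_index (A *\<^sub>v v) i = (\<Sum>k<n. q i k * vec_index v k)"
      using that v(1) by (simp add: A_def scalar_prod_def lessThan_atLeast0)
    then show ?thesis using v(3) that by simp
  qed
  then show ?thesis using c
    by (intro exI[of _ "\<lambda>k. vec_index v k / sqrt c"])
      (auto simp: c_def[symmetric] sum_divide_distrib[symmetric])
qed


text \<open>Induction on the number of missing columns. \<open>S\<close> is an arbitrary index set
  and not an initial segment, because the given vectors have to keep their column positions.\<close>

lemma orthonormal_extend:
  fixes q :: "nat \<Rightarrow> nat \<Rightarrow> real"
  assumes "S \<subseteq> {..<n}"
    and "\<And>i j. i \<in> S \<Longrightarrow> j \<in> S \<Longrightarrow> (\<Sum>k<n. q i k * q j k) = (if i = j then 1 else 0)"
  shows "\<exists>Q. orth_mat n Q \<and> (\<forall>i\<in>S. \<forall>k<n. Q $$ (k,i) = q i k)"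
  using assms
proof (induction "card ({..<n} - S)" arbitrary: S q)
  case 0
  then have S: "S = {..<n}" by auto
  define Q where "Q = mat n n (\<lambda>(k,i). q i k)"
  \<comment> \<open>Orthonormal columns give the product in this order, whereas
    \<open>orth_mat\<close> asks for the other one; hence the detour through the transpose.\<close>
  have "transpose_mat Q * Q = 1\<^sub>m n"
    by (intro eq_matI) (auto simp: Q_def mat_mult_entry 0 S)
  then have "orth_mat n (transpose_mat Q)" by (auto simp: orth_mat_def Q_def)
  then have "orth_mat n Q" using orth_mat_transpose by fastforce
  then show ?case using S by (intro exI[of _ Q]) (auto simp: Q_def)
next
  case (Suc c)
  then have "{..<n} - S \<noteq> {}" by force
  then obtain a where a: "a < n" "a \<notin> S" by auto
  obtain v where v: "(\<Sum>k<n. v k * v k) = 1" "\<forall>i\<in>S \<inter> {..<n}. (\<Sum>k<n. q i k * v k) = 0"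
    using exists_orthogonal_vector[OF a] by blast
  define q' where "q' = q(a := v)"
  have "c = card ({..<n} - insert a S)"
    using Suc(2) a by (metis Diff_insert DiffI card_Diff_singleton diff_Suc_1 lessThan_iff)
  moreover have "(\<Sum>k<n. q' i k * q' j k) = (if i = j then 1 else 0)"
    if "i \<in> insert a S" "j \<in> insert a S" for i j
    using that a Suc.prems v by (auto simp: q'_def mult.commute)
  moreover have "insert a S \<subseteq> {..<n}" using a Suc.prems by auto
  ultimately obtain Q where "orth_mat n Q" "\<forall>i\<in>insert a S. \<forall>k<n. Q $$ (k,i) = q' i k"
    using Suc.hyps(1)[of "insert a S" q'] by blast
  then show ?case using a by (intro exI[of _ Q]) (force simp: q'_def)
qed

text \<open>The columns with \<open>c i \<noteq> 0\<close>, divided by \<open>c i\<close>, are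
  orthonormal and are completed to \<open>Q\<close>. The other columns of \<open>X\<close> have norm
  0, so it does not matter what the completion puts there. The last hypothesis makes every
  normalized column index a legal column index of the m x m matrix \<open>Q\<close>.\<close>

lemma orthogonal_columns:
  assumes X: "X \<in> carrier_mat m n"
    and XX: "transpose_mat X * X = diag_rect n n (\<lambda>i. c i ^ 2)"
    and c: "\<And>i. m \<le> i \<Longrightarrow> i < n \<Longrightarrow> c i = 0"
  shows "\<exists>Q. orth_mat m Q \<and> X = Q * diag_rect m n c"
proof -
  define S where "S = {i. i < n \<and> c i \<noteq> 0}"
  have ip: "(\<Sum>k<m. X $$ (k,i) * X $$ (k,j)) = (if i = j then c i ^ 2 else 0)"
    if "i < n" "j < n" for i j
  proof -
    have "(transpose_mat X * X) $$ (i,j) = (\<Sum>k<m. X $$ (k,i) * X $$ (k,j))"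
      using X that by (simp add: mat_mult_entry)
    then show ?thesis using that by (simp add: XX)
  qed
  have "i < m" if "i \<in> S" for i
    using c[of i] that by (cases "m \<le> i") (auto simp: S_def)
  then have "S \<subseteq> {..<m}" by auto
  moreover have "(\<Sum>k<m. (X $$ (k,i) / c i) * (X $$ (k,j) / c j)) = (if i = j then 1 else 0)"
    if "i \<in> S" "j \<in> S" for i j
  proof -
    have "(\<Sum>k<m. (X $$ (k,i) / c i) * (X $$ (k,j) / c j)) = (\<Sum>k<m. X $$ (k,i) * X $$ (k,j)) / (c i * c j)"
      by (simp add: sum_divide_distrib)
    then show ?thesis using that ip[of i j] by (simp add: S_def power2_eq_square)
  qed
  ultimately obtain Q where Q: "orth_mat m Q" "\<forall>i\<in>S. \<forall>k<m. Q $$ (k,i) = X $$ (k,i) / c i"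
    using orthonormal_extend[of S m "\<lambda>i k. X $$ (k,i) / c i"] by blast
  have "X $$ (k,j) = (Q * diag_rect m n c) $$ (k,j)" if k: "k < m" and j: "j < n" for k j
  proof (cases "j \<in> S")
    case True
    then show ?thesis using Q that \<open>S \<subseteq> {..<m}\<close> orth_matD[OF Q(1)]
      by (auto simp: mult_diag_rect_entry S_def)
  next
    case False
    then have c0: "c j = 0" using j by (simp add: S_def)
    then have "(\<Sum>k<m. X $$ (k,j) * X $$ (k,j)) = 0" using ip[OF j j] by simp
    then have "\<forall>k\<in>{..<m}. X $$ (k,j) * X $$ (k,j) = 0" by (subst (asm) sum_nonneg_eq_0_iff) auto
    then show ?thesis using k j c0 orth_matD[OF Q(1)] by (auto simp: mult_diag_rect_entry)
  qed
  then have "X = Q * diag_rect m n c"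
    using X orth_matD[OF Q(1)] by (intro eq_matI) auto
  then show ?thesis using Q(1) by blast
qed

text \<open>A complex eigenvalue \<open>a + ib\<close> with eigenvector \<open>x + iy\<close> satisfies
  \<open>-b|y|\<^sup>2 = b|x|\<^sup>2\<close> by symmetry, so it is real.\<close>

lemma symmetric_real_eigenvector:
  assumes A: "A \<in> carrier_mat n n" and sym: "transpose_mat A = A" and n: "n > 0"
  shows "\<exists>e v. (\<Sum>k<n. v k * v k) = (1::real) \<and> (\<forall>i<n. (\<Sum>k<n. A $$ (i,k) * v k) = e * v i)"
proof -
  define B where "B = map_mat complex_of_real A"
  have B: "B \<in> carrier_mat n n" using A by (simp add: B_def)
  obtain z v where "eigenvector B v z"
    using spectrum_non_empty[OF B n] by (auto simp: spectrum_def eigenvalue_def)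
  then have v: "v \<in> carrier_vec n" "v \<noteq> 0\<^sub>v n" "B *\<^sub>v v = z \<cdot>\<^sub>v v"
    using B by (auto simp: eigenvector_def)
  define a b x y where "a = Re z" and "b = Im z"
    and "x = (\<lambda>k. Re (vec_index v k))" and "y = (\<lambda>k. Im (vec_index v k))"
  have ev: "(\<Sum>k<n. complex_of_real (A $$ (i,k)) * vec_index v k) = z * vec_index v i" if "i < n" for i
  proof -
    have "vec_index (B *\<^sub>v v) i = (\<Sum>k<n. complex_of_real (A $$ (i,k)) * vec_index v k)"
      using that v(1) A by (simp add: B_def scalar_prod_def lessThan_atLeast0)
    then show ?thesis using that v(1) by (simp add: v(3))
  qed
  have Ax: "(\<Sum>k<n. A $$ (i,k) * x k) = a * x i - b * y i"
    and Ay: "(\<Sum>k<n. A $$ (i,k) * y k) = a * y i + b * x i" if "i < n" for i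
    using arg_cong[OF ev[OF that], of Re] arg_cong[OF ev[OF that], of Im]
    by (simp_all add: a_def b_def x_def y_def)
  have symA: "A $$ (i,k) = A $$ (k,i)" if "i < n" "k < n" for i k
    using that A arg_cong[OF sym, of "\<lambda>M. M $$ (i,k)"] by simp
  have "(\<Sum>i<n. y i * (a * x i - b * y i)) = (\<Sum>i<n. \<Sum>k<n. y i * (A $$ (i,k) * x k))"
    by (simp add: Ax[symmetric] sum_distrib_left)
  also have "\<dots> = (\<Sum>k<n. \<Sum>i<n. x k * (A $$ (k,i) * y i))"
    by (subst sum.swap) (auto intro!: sum.cong simp: symA)
  also have "\<dots> = (\<Sum>k<n. x k * (a * y k + b * x k))"
    by (simp add: Ay[symmetric] sum_distrib_left)
  finally have "b * (\<Sum>i<n. x i * x i + y i * y i) = 0"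
    by (simp add: algebra_simps sum.distrib sum_subtractf sum_distrib_left)
  moreover obtain j where j: "j < n" "vec_index v j \<noteq> 0"
    using v by (metis carrier_vecD eq_vecI index_zero_vec)
  have sq: "(\<Sum>i<n. u i * u i) > 0" if "u j \<noteq> 0" for u :: "nat \<Rightarrow> real"
    by (rule sum_pos2[of _ j]) (use j that in \<open>auto simp: zero_less_mult_iff linorder_neq_iff\<close>)
  have xy: "x j \<noteq> 0 \<or> y j \<noteq> 0" using j by (auto simp: x_def y_def complex_eq_iff)
  have "(\<Sum>i<n. x i * x i + y i * y i) > 0"
    by (rule sum_pos2[of _ j])
      (use j xy in \<open>auto simp: add_pos_nonneg add_nonneg_pos zero_less_mult_iff linorder_neq_iff\<close>)
  ultimately have b: "b = 0" by simp
  \<comment> \<open>With \<open>b = 0\<close> the real and the imaginary part both satisfy the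
    eigenvalue equation; the one that is nonzero at \<open>j\<close> is taken.\<close>
  define u where "u = (if x j = 0 then y else x)"
  have u: "u j \<noteq> 0" "\<And>i. i < n \<Longrightarrow> (\<Sum>k<n. A $$ (i,k) * u k) = a * u i"
    using xy by (simp_all add: u_def Ax Ay b)
  define c where "c = (\<Sum>i<n. u i * u i)"
  have c: "c > 0" using sq[of u] u(1) by (simp add: c_def)
  show ?thesis
  proof (intro exI conjI allI impI)
    show "(\<Sum>k<n. u k / sqrt c * (u k / sqrt c)) = 1"
      using c by (simp add: sum_divide_distrib[symmetric] c_def[symmetric])
    show "(\<Sum>k<n. A $$ (i,k) * (u k / sqrt c)) = a * (u i / sqrt c)" if "i < n" for i
      using u(2)[OF that] by (simp add: sum_divide_distrib[symmetric])
  qed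
qed

section \<open>Block-diagonal matrices and the spectral theorem\<close>

text \<open>The two-block step of \<open>blkD\<close>, kept as a constant of its own so that
  products, transposes and orthogonality are proved once for two blocks.\<close>

definition block2 :: "real mat \<Rightarrow> real mat \<Rightarrow> real mat" where
  "block2 A B = four_block_mat A (0\<^sub>m (dim_row A) (dim_col B)) (0\<^sub>m (dim_row B) (dim_col A)) B"

lemma block2_dim [simp]:
  "dim_row (block2 A B) = dim_row A + dim_row B" "dim_col (block2 A B) = dim_col A + dim_col B"
  by (simp_all add: block2_def)

lemma block2_entry:
  assumes "i < dim_row A + dim_row B" "j < dim_col A + dim_col B"
  shows "block2 A B $$ (i,j) =
    (if i < dim_row A then if j < dim_col A then A $$ (i,j) else 0
     else if j < dim_col A then 0 else B $$ (i - dim_row A, j - dim_col A))"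
  using assms by (auto simp: block2_def)

lemma block2_mult:
  assumes "dim_col A = dim_row C" "dim_col B = dim_row D"
  shows "block2 A B * block2 C D = block2 (A * C) (B * D)"
proof -
  have "block2 A B * block2 C D = four_block_mat
      (A * C + 0\<^sub>m (dim_row A) (dim_col B) * 0\<^sub>m (dim_row D) (dim_col C))
      (A * 0\<^sub>m (dim_row C) (dim_col D) + 0\<^sub>m (dim_row A) (dim_col B) * D)
      (0\<^sub>m (dim_row B) (dim_col A) * C + B * 0\<^sub>m (dim_row D) (dim_col C))
      (0\<^sub>m (dim_row B) (dim_col A) * 0\<^sub>m (dim_row C) (dim_col D) + B * D)"
    unfolding block2_def
    by (rule mult_four_block_mat[of _ "dim_row A" "dim_col A" _ "dim_col B" _ "dim_row B"
          _ _ "dim_col C" _ "dim_col D"])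
      (use assms in \<open>auto intro: carrier_matI\<close>)
  also have "\<dots> = block2 (A * C) (B * D)"
    unfolding block2_def
    by (rule cong_four_block_mat) (use assms in \<open>auto intro!: eq_matI simp: mat_mult_entry\<close>)
  finally show ?thesis .
qed

lemma block2_transpose: "transpose_mat (block2 A B) = block2 (transpose_mat A) (transpose_mat B)"
  by (intro eq_matI) (auto simp: block2_entry)

lemma block2_orth:
  assumes "orth_mat m A" "orth_mat n B"
  shows "orth_mat (m + n) (block2 A B)"
proof -
  note A = orth_matD[OF assms(1)] and B = orth_matD[OF assms(2)]
  have "block2 A B * transpose_mat (block2 A B) = 1\<^sub>m (m + n)"
    using A(2-4) B(2-4) by (simp add: block2_transpose block2_mult) (simp add: block2_def)
  then show ?thesis using A(2,3) B(2,3) by (auto simp: orth_mat_def)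
qed

lemma block2_diag_rect:
  "block2 (diag_rect m m f) (diag_rect n n g)
    = diag_rect (m + n) (m + n) (\<lambda>i. if i < m then f i else g (i - m))"
  by (intro eq_matI) (auto simp: block2_entry)

lemma block2_split:
  assumes M: "M \<in> carrier_mat (m + n) (m + n)"
    and off: "\<And>i j. i < m \<Longrightarrow> m \<le> j \<Longrightarrow> j < m + n \<Longrightarrow> M $$ (i,j) = 0 \<and> M $$ (j,i) = 0"
  shows "M = block2 (mat m m (\<lambda>(i,j). M $$ (i,j))) (mat n n (\<lambda>(i,j). M $$ (m + i, m + j)))"
  using M off by (intro eq_matI) (auto simp: block2_entry)

text \<open>Deflation: with a unit eigenvector as column 0 of \<open>Q\<close>, symmetry splits
  \<open>Q^T A Q\<close> into a 1 x 1 block and a smaller symmetric block. The form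
  \<open>P A P^T\<close> is the one in which the blocks \<open>Ob i\<close> stand in the first
  layer.\<close>

lemma symmetric_diagonalization:
  fixes A :: "real mat"
  assumes "A \<in> carrier_mat n n" "transpose_mat A = A"
  shows "\<exists>P e. orth_mat n P \<and> P * A * transpose_mat P = diag_rect n n e"
  using assms
proof (induction n arbitrary: A)
  case 0
  then show ?case
    by (intro exI[of _ "1\<^sub>m 0"] exI[of _ "\<lambda>_. 0"]) (auto simp: orth_mat_one intro!: eq_matI)
next
  case (Suc n)
  obtain e v where v: "(\<Sum>k<Suc n. v k * v k) = (1::real)"
    "\<forall>i<Suc n. (\<Sum>k<Suc n. A $$ (i,k) * v k) = e * v i"
    using symmetric_real_eigenvector[OF Suc.prems] by blast
  obtain Q where Q: "orth_mat (Suc n) Q" "\<forall>k<Suc n. Q $$ (k,0) = v k"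
    using orthonormal_extend[of "{0}" "Suc n" "\<lambda>_. v"] v(1) by auto
  note Qc = orth_matD[OF Q(1)]
  have dA: "dim_row A = Suc n" "dim_col A = Suc n" using Suc.prems by auto
  define M where "M = transpose_mat Q * (A * Q)"
  have M: "M \<in> carrier_mat (1 + n) (1 + n)" using Qc by (auto simp: M_def)
  have Msym: "transpose_mat M = M"
    using Qc dA Suc.prems(2) by (simp add: M_def mat_transpose_mult mat_assoc)
  have AQ: "(A * Q) $$ (i,0) = e * Q $$ (i,0)" if "i < Suc n" for i
    using that v(2) Q(2) dA Qc(2,3) by (auto simp: mat_mult_entry)
  have M0: "M $$ (i,0) = (if i = 0 then e else 0)" if "i < Suc n" for i
  proof -
    have "M $$ (i,0) = (\<Sum>k<Suc n. Q $$ (k,i) * (e * Q $$ (k,0)))"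
      using that Qc(2,3) dA AQ by (simp add: M_def mat_mult_entry[of i "transpose_mat Q"])
    also have "\<dots> = e * (transpose_mat Q * Q) $$ (i,0)"
      using that Qc(2,3) by (simp add: mat_mult_entry sum_distrib_left algebra_simps)
    finally show ?thesis using that by (simp add: Qc(5))
  qed
  have M0': "M $$ (0,i) = (if i = 0 then e else 0)" if "i < Suc n" for i
    using M0[OF that] that M arg_cong[OF Msym, of "\<lambda>X. X $$ (i,0)"] by simp
  define N where "N = mat n n (\<lambda>(i,j). M $$ (1 + i, 1 + j))"
  have N: "N \<in> carrier_mat n n" by (simp add: N_def)
  have Nsym: "transpose_mat N = N"
  proof (rule eq_matI)
    fix i j assume "i < dim_row N" "j < dim_col N"
    then show "transpose_mat N $$ (i,j) = N $$ (i,j)"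
      using M arg_cong[OF Msym, of "\<lambda>X. X $$ (1 + i, 1 + j)"] by (simp add: N_def)
  qed (simp_all add: N_def)
  obtain P f where P: "orth_mat n P" "P * N * transpose_mat P = diag_rect n n f"
    using Suc.IH[OF N Nsym] by blast
  have "M = block2 (mat 1 1 (\<lambda>(i,j). M $$ (i,j))) N"
    unfolding N_def by (rule block2_split[OF M]) (use M0 M0' in auto)
  also have "mat 1 1 (\<lambda>(i,j). M $$ (i,j)) = diag_rect 1 1 (\<lambda>_. e)"
    using M0[of 0] by (intro eq_matI) auto
  finally have Mb: "M = block2 (diag_rect 1 1 (\<lambda>_. e)) N" .
  define R where "R = block2 (1\<^sub>m 1) P"
  have R: "orth_mat (Suc n) R"
    using block2_orth[OF orth_mat_one[of 1] P(1)] by (simp add: R_def)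
  have dR: "dim_row R = Suc n" "dim_col R = Suc n" using orth_matD[OF R] by auto
  have dP: "dim_row P = n" "dim_col P = n" using orth_matD[OF P(1)] by auto
  have "R * transpose_mat Q * A * transpose_mat (R * transpose_mat Q) = R * M * transpose_mat R"
    using Qc(2,3) dR dA by (simp add: M_def mat_transpose_mult mat_assoc)
  also have "\<dots> = block2 (diag_rect 1 1 (\<lambda>_. e)) (P * N * transpose_mat P)"
    using N dP unfolding Mb R_def by (simp add: block2_mult block2_transpose)
  also have "\<dots> = diag_rect (Suc n) (Suc n) (\<lambda>i. if i < 1 then e else f (i - 1))"
    by (simp only: P(2) block2_diag_rect plus_1_eq_Suc)
  finally show ?case
    using orth_mat_mult[OF R orth_mat_transpose[OF Q(1)]] by blast
qed

section \<open>Block-diagonal matrices with block bounds \<open>s\<close>\<close>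

lemma blkD_Cons: "blkD (A # As) = block2 A (blkD As)"
  by (simp add: block2_def Let_def)

text \<open>\<open>blkD\<close> peels off the first block, but the bounds \<open>s\<close> grow at
  the end and \<open>Op1\<close> and \<open>Ohat\<close> are appended there, so the inductions over
  blocks need the last one.\<close>

lemma blkD_snoc: "blkD (As @ [A]) = block2 (blkD As) A"
proof (induction As)
  case Nil
  show ?case by (rule eq_matI) (auto simp: block2_def Let_def)
next
  case (Cons B As)
  have "block2 B (block2 (blkD As) A) = block2 (block2 B (blkD As)) A"
    unfolding block2_def by (rule assoc_four_block_mat)
  then show ?case using Cons by (simp only: append_Cons blkD_Cons)
qed

lemma blkD_transpose: "blkD (map transpose_mat As) = transpose_mat (blkD As)"
proof (induction As)
  case (Cons A As)
  then show ?case by (simp only: list.map blkD_Cons block2_transpose)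
qed (auto intro!: eq_matI)

definition same_block :: "(nat \<Rightarrow> nat) \<Rightarrow> nat \<Rightarrow> nat \<Rightarrow> nat \<Rightarrow> bool" where
  "same_block s p i j \<longleftrightarrow>
    (\<exists>k\<in>{1..p}. s (k - 1) \<le> i \<and> i < s k \<and> s (k - 1) \<le> j \<and> j < s k)"

lemma block_bounds_mono:
  fixes s :: "nat \<Rightarrow> nat"
  assumes "\<forall>k\<in>{1..p}. s (k - 1) < s k" "j \<le> k" "k \<le> p"
  shows "s j \<le> s k"
  using assms(2,3)
proof (induction rule: dec_induct)
  case (step n)
  then have "s n < s (Suc n)" using assms(1)[rule_format, of "Suc n"] by simp
  then show ?case using step by simp
qed simp

text \<open>The bounds increase, so an index below \<open>s p\<close> cannot lie in the new block,
  which starts at \<open>s p\<close>.\<close>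

lemma same_block_Suc:
  fixes s :: "nat \<Rightarrow> nat"
  assumes s: "\<forall>k\<in>{1..Suc p}. s (k - 1) < s k" and i: "i < s p"
  shows "same_block s (Suc p) i j \<longleftrightarrow> same_block s p i j"
    and "same_block s (Suc p) i j \<Longrightarrow> j < s p"
    and "same_block s (Suc p) j i \<Longrightarrow> j < s p"
proof -
  have le: "k \<in> {1..p}" if "k \<in> {1..Suc p}" "s (k - 1) \<le> i" for k
    using that i by (cases "k = Suc p") auto
  have mono: "s k \<le> s p" if "k \<in> {1..p}" for k
    using block_bounds_mono[of p s k p] s that by auto
  show "same_block s (Suc p) i j \<longleftrightarrow> same_block s p i j"
    using le unfolding same_block_def by fastforce
  show "same_block s (Suc p) i j \<Longrightarrow> j < s p" "same_block s (Suc p) j i \<Longrightarrow> j < s p"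
    using le mono unfolding same_block_def by (meson order_less_le_trans)+
qed

lemma blkD_orth:
  assumes "s 0 = 0" "\<forall>k\<in>{1..p}. s (k - 1) < s k" "\<forall>k\<in>{1..p}. orth_mat (s k - s (k - 1)) (Ob k)"
  shows "orth_mat (s p) (blkD (map Ob [1..<p + 1]))"
  using assms
proof (induction p)
  case 0
  then show ?case by (auto simp: orth_mat_def intro!: eq_matI)
next
  case (Suc p)
  have s: "s p < s (Suc p)" using Suc.prems(2)[rule_format, of "Suc p"] by simp
  have "orth_mat (s p + (s (Suc p) - s p)) (block2 (blkD (map Ob [1..<p + 1])) (Ob (Suc p)))"
    by (rule block2_orth) (use Suc Suc.prems(3)[rule_format, of "Suc p"] in simp_all)
  then show ?case using s by (simp add: blkD_snoc)
qed

lemma blkD_entry_zero: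
  assumes "s 0 = 0" "\<forall>k\<in>{1..p}. s (k - 1) < s k" "\<forall>k\<in>{1..p}. orth_mat (s k - s (k - 1)) (Ob k)"
    and "i < s p" "j < s p" "\<not> same_block s p i j"
  shows "blkD (map Ob [1..<p + 1]) $$ (i,j) = 0"
  using assms
proof (induction p)
  case (Suc p)
  have s: "s p < s (Suc p)" using Suc.prems(2)[rule_format, of "Suc p"] by simp
  have B: "orth_mat (s p) (blkD (map Ob [1..<p + 1]))"
    by (rule blkD_orth) (use Suc.prems in auto)
  have O: "orth_mat (s (Suc p) - s p) (Ob (Suc p))"
    using Suc.prems(3)[rule_format, of "Suc p"] by simp
  have "\<not> (s p \<le> i \<and> s p \<le> j)"
    using Suc.prems(4-6) by (auto simp: same_block_def)
  moreover have "blkD (map Ob [1..<p + 1]) $$ (i,j) = 0" if "i < s p" "j < s p"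
    using that Suc same_block_Suc(1)[OF Suc.prems(2)] by simp
  ultimately show ?case
    using Suc.prems(4,5) s orth_matD(2,3)[OF B] orth_matD(2,3)[OF O]
    by (auto simp: blkD_snoc block2_entry)
qed simp

text \<open>The spectral theorem applied to each block separately. One application to all of
  \<open>M\<close> would not give a block-diagonal rotation, and only such a rotation can be moved
  past the singular values of \<open>Y\<close>.\<close>

lemma block_symmetric_diagonalization:
  fixes M :: "real mat"
  assumes "s 0 = 0" "\<forall>k\<in>{1..p}. s (k - 1) < s k"
    and "M \<in> carrier_mat (s p) (s p)" "transpose_mat M = M"
    and "\<And>i j. i < s p \<Longrightarrow> j < s p \<Longrightarrow> \<not> same_block s p i j \<Longrightarrow> M $$ (i,j) = 0"
  shows "\<exists>Ob e. (\<forall>k\<in>{1..p}. orth_mat (s k - s (k - 1)) (Ob k)) \<and>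
    blkD (map Ob [1..<p + 1]) * M * transpose_mat (blkD (map Ob [1..<p + 1])) = diag_rect (s p) (s p) e"
  using assms
proof (induction p arbitrary: M)
  case 0
  then show ?case by (auto intro!: eq_matI)
next
  case (Suc p)
  define h where "h = s (Suc p) - s p"
  have s: "s (Suc p) = s p + h" using Suc.prems(2)[rule_format, of "Suc p"] by (simp add: h_def)
  have sym: "M $$ (i,j) = M $$ (j,i)" if "i < s (Suc p)" "j < s (Suc p)" for i j
    using that Suc.prems(3) arg_cong[OF Suc.prems(4), of "\<lambda>X. X $$ (i,j)"] by simp
  define M1 M2 where "M1 = mat (s p) (s p) (\<lambda>(i,j). M $$ (i,j))"
    and "M2 = mat h h (\<lambda>(i,j). M $$ (s p + i, s p + j))"
  have M: "M = block2 M1 M2"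
    unfolding M1_def M2_def
  proof (rule block2_split)
    show "M \<in> carrier_mat (s p + h) (s p + h)" using Suc.prems(3) by (simp add: s)
    show "M $$ (i,j) = 0 \<and> M $$ (j,i) = 0" if "i < s p" "s p \<le> j" "j < s p + h" for i j
      using Suc.prems(5)[of i j] Suc.prems(5)[of j i] same_block_Suc(2,3)[OF Suc.prems(2) that(1), of j] that
      by (auto simp: s)
  qed
  have "\<exists>Ob e. (\<forall>k\<in>{1..p}. orth_mat (s k - s (k - 1)) (Ob k)) \<and>
    blkD (map Ob [1..<p + 1]) * M1 * transpose_mat (blkD (map Ob [1..<p + 1])) = diag_rect (s p) (s p) e"
  proof (rule Suc.IH)
    show "transpose_mat M1 = M1" by (rule eq_matI) (auto simp: M1_def sym s)
    show "M1 $$ (i,j) = 0" if "i < s p" "j < s p" "\<not> same_block s p i j" for i j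
      using that Suc.prems(5)[of i j] same_block_Suc(1)[OF Suc.prems(2)] by (simp add: M1_def s)
  qed (use Suc.prems in \<open>auto simp: M1_def\<close>)
  then obtain Ob e where Ob: "\<forall>k\<in>{1..p}. orth_mat (s k - s (k - 1)) (Ob k)"
    and e: "blkD (map Ob [1..<p + 1]) * M1 * transpose_mat (blkD (map Ob [1..<p + 1])) = diag_rect (s p) (s p) e"
    by blast
  have "transpose_mat M2 = M2" by (rule eq_matI) (auto simp: M2_def sym s)
  then obtain P f where P: "orth_mat h P" "P * M2 * transpose_mat P = diag_rect h h f"
    using symmetric_diagonalization[of M2 h] by (auto simp: M2_def)
  define Ob' where "Ob' = Ob(Suc p := P)"
  have blk: "blkD (map Ob' [1..<Suc p + 1]) = block2 (blkD (map Ob [1..<p + 1])) P"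
  proof -
    have "map Ob' [1..<p + 1] = map Ob [1..<p + 1]" by (auto simp: Ob'_def)
    moreover have "[1..<Suc p + 1] = [1..<p + 1] @ [Suc p]" by simp
    ultimately show ?thesis by (simp only: map_append list.map blkD_snoc) (simp add: Ob'_def)
  qed
  have "orth_mat (s p) (blkD (map Ob [1..<p + 1]))"
    by (rule blkD_orth) (use Suc.prems Ob in auto)
  note dims = orth_matD(2,3)[OF this] orth_matD(2,3)[OF P(1)]
  have "blkD (map Ob' [1..<Suc p + 1]) * M * transpose_mat (blkD (map Ob' [1..<Suc p + 1]))
    = block2 (diag_rect (s p) (s p) e) (diag_rect h h f)"
    unfolding blk M e[symmetric] P(2)[symmetric] using dims
    by (simp add: block2_transpose block2_mult M1_def M2_def)
  then have "blkD (map Ob' [1..<Suc p + 1]) * M * transpose_mat (blkD (map Ob' [1..<Suc p + 1]))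
    = diag_rect (s (Suc p)) (s (Suc p)) (\<lambda>i. if i < s p then e i else f (i - s p))"
    by (simp only: block2_diag_rect s)
  moreover have "\<forall>k\<in>{1..Suc p}. orth_mat (s k - s (k - 1)) (Ob' k)"
    using Ob P(1) by (auto simp: Ob'_def h_def)
  ultimately show ?case by blast
qed

section \<open>The gradient of the loss\<close>

text \<open>The Frobenius inner product, the trace of \<open>A^T B\<close>.\<close>

definition mat_ip :: "real mat \<Rightarrow> real mat \<Rightarrow> real" where
  "mat_ip A B = (\<Sum>i<dim_row A. \<Sum>j<dim_col A. A $$ (i,j) * B $$ (i,j))"

text \<open>Left multiplication by \<open>B\<close> has adjoint left multiplication by
  \<open>B^T\<close>: both sides are the same triple sum, summed in different orders.\<close>

lemma mat_ip_mult_left: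
  assumes "dim_row A = dim_row B" "dim_col B = dim_row C" "dim_col C = dim_col A"
  shows "mat_ip A (B * C) = mat_ip (transpose_mat B * A) C"
proof -
  have "mat_ip A (B * C) = (\<Sum>i<dim_row A. \<Sum>j<dim_col A. \<Sum>k<dim_row C. A $$ (i,j) * (B $$ (i,k) * C $$ (k,j)))"
    using assms by (simp add: mat_ip_def mat_mult_entry sum_distrib_left)
  also have "\<dots> = (\<Sum>i<dim_row A. \<Sum>k<dim_row C. \<Sum>j<dim_col A. A $$ (i,j) * (B $$ (i,k) * C $$ (k,j)))"
    by (intro sum.cong refl sum.swap)
  also have "\<dots> = (\<Sum>k<dim_row C. \<Sum>i<dim_row A. \<Sum>j<dim_col A. A $$ (i,j) * (B $$ (i,k) * C $$ (k,j)))"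
    by (rule sum.swap)
  also have "\<dots> = (\<Sum>k<dim_row C. \<Sum>j<dim_col A. \<Sum>i<dim_row A. A $$ (i,j) * (B $$ (i,k) * C $$ (k,j)))"
    by (intro sum.cong refl sum.swap)
  also have "\<dots> = mat_ip (transpose_mat B * A) C"
    using assms by (simp add: mat_ip_def mat_mult_entry sum_distrib_left sum_distrib_right algebra_simps)
  finally show ?thesis .
qed

lemma mat_ip_transpose:
  assumes "dim_row A = dim_row B" "dim_col A = dim_col B"
  shows "mat_ip (transpose_mat A) (transpose_mat B) = mat_ip A B"
  using assms by (simp add: mat_ip_def) (rule sum.swap)

lemma mat_ip_mult_right:
  assumes "dim_row A = dim_row B" "dim_col B = dim_row C" "dim_col C = dim_col A"
  shows "mat_ip A (B * C) = mat_ip (A * transpose_mat C) B"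
proof -
  have "mat_ip A (B * C) = mat_ip (transpose_mat A) (transpose_mat (B * C))"
    by (rule mat_ip_transpose[symmetric]) (use assms in simp_all)
  also have "\<dots> = mat_ip (transpose_mat A) (transpose_mat C * transpose_mat B)"
    using assms by (simp add: mat_transpose_mult)
  also have "\<dots> = mat_ip (C * transpose_mat A) (transpose_mat B)"
    using assms by (simp add: mat_ip_mult_left)
  also have "C * transpose_mat A = transpose_mat (A * transpose_mat C)"
    using assms by (simp add: mat_transpose_mult)
  also have "mat_ip (transpose_mat (A * transpose_mat C)) (transpose_mat B) = mat_ip (A * transpose_mat C) B"
    by (rule mat_ip_transpose) (use assms in simp_all)
  finally show ?thesis .
qed

lemma mat_ip_add_right:
  assumes "dim_row B = dim_row A" "dim_col B = dim_col A" "dim_row C = dim_row A" "dim_col C = dim_col A"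
  shows "mat_ip A (B + C) = mat_ip A B + mat_ip A C"
  using assms by (simp add: mat_ip_def algebra_simps sum.distrib)

lemma mat_ip_add_left:
  assumes "dim_row B = dim_row A" "dim_col B = dim_col A"
  shows "mat_ip (A + B) C = mat_ip A C + mat_ip B C"
  using assms by (simp add: mat_ip_def algebra_simps sum.distrib)

lemma mat_ip_smult_left: "mat_ip (c \<cdot>\<^sub>m A) B = c * mat_ip A B"
  by (simp add: mat_ip_def sum_distrib_left algebra_simps)

lemma mat_ip_self_eq_0:
  assumes "mat_ip A A = 0"
  shows "A = 0\<^sub>m (dim_row A) (dim_col A)"
proof (rule eq_matI)
  fix i j assume ij: "i < dim_row (0\<^sub>m (dim_row A) (dim_col A) :: real mat)"
    "j < dim_col (0\<^sub>m (dim_row A) (dim_col A) :: real mat)"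
  have "A $$ (i,j) * A $$ (i,j) \<le> (\<Sum>j<dim_col A. A $$ (i,j) * A $$ (i,j))"
    by (rule member_le_sum[of j _ "\<lambda>j. A $$ (i,j) * A $$ (i,j)"]) (use ij in auto)
  also have "\<dots> \<le> mat_ip A A"
    unfolding mat_ip_def
    by (rule member_le_sum[of i _ "\<lambda>i. \<Sum>j<dim_col A. A $$ (i,j) * A $$ (i,j)"])
      (use ij in \<open>auto intro: sum_nonneg\<close>)
  finally have "A $$ (i,j) * A $$ (i,j) \<le> 0" using assms by simp
  then have "A $$ (i,j) = 0" by (metis mult_eq_0_iff order_antisym zero_le_square)
  then show "A $$ (i,j) = 0\<^sub>m (dim_row A) (dim_col A) $$ (i,j)" using ij by simp
qed simp_all

section \<open>Directional derivative of the matrix product, and backpropagation\<close>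

fun chain_deriv :: "(nat \<Rightarrow> nat) \<Rightarrow> (nat \<Rightarrow> real mat) \<Rightarrow> (nat \<Rightarrow> real mat) \<Rightarrow> nat \<Rightarrow> real mat" where
  "chain_deriv d W D 0 = 0\<^sub>m (d 0) (d 0)"
| "chain_deriv d W D (Suc l) = D (Suc l) * chain d W l + W (Suc l) * chain_deriv d W D l"

lemma chain_dim:
  assumes "\<forall>l\<in>{1..L}. W l \<in> carrier_mat (d l) (d (l - 1))" "l \<le> L"
  shows "dim_row (chain d W l) = d l" "dim_col (chain d W l) = d 0"
  using assms(2)
proof (induction l)
  case (Suc l)
  { case 1 then show ?case using assms(1)[rule_format, of "Suc l"] by simp }
  { case 2 then show ?case using Suc by simp }
qed simp_all

lemma chain_deriv_dim:
  assumes "\<forall>l\<in>{1..L}. W l \<in> carrier_mat (d l) (d (l - 1))" "l \<le> L"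
  shows "dim_row (chain_deriv d W D l) = d l" "dim_col (chain_deriv d W D l) = d 0"
  using assms(2)
proof (induction l)
  case (Suc l)
  { case 1 then show ?case using assms(1)[rule_format, of "Suc l"] by simp }
  { case 2 then show ?case using Suc by simp }
qed simp_all

text \<open>The recursion of \<open>chain_deriv\<close> is the product rule. Differentiation is done
  entry by entry, each entry being a real function of \<open>t\<close>.\<close>

lemma has_derivative_chain:
  assumes W: "\<forall>l\<in>{1..L}. W l \<in> carrier_mat (d l) (d (l - 1))"
    and D: "\<forall>l\<in>{1..L}. D l \<in> carrier_mat (d l) (d (l - 1))"
    and "l \<le> L" "i < d l" "j < d 0"
  shows "((\<lambda>t. chain d (\<lambda>l. W l + t \<cdot>\<^sub>m D l) l $$ (i,j)) has_real_derivative chain_deriv d W D l $$ (i,j)) (at 0)"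
  using assms(3-)
proof (induction l arbitrary: i j)
  case (Suc l)
  define V where "V = (\<lambda>t l. W l + t \<cdot>\<^sub>m D l)"
  have V: "\<forall>l\<in>{1..L}. V t l \<in> carrier_mat (d l) (d (l - 1))" for t
    using W D by (simp add: V_def)
  have l: "l \<le> L" "Suc l \<in> {1..L}" using Suc.prems by auto
  note dims = chain_dim[OF V l(1)] chain_dim[OF W l(1)] chain_deriv_dim[OF W l(1)]
  have WS: "dim_row (W (Suc l)) = d (Suc l)" "dim_col (W (Suc l)) = d l"
    "dim_row (D (Suc l)) = d (Suc l)" "dim_col (D (Suc l)) = d l"
    using W[rule_format, OF l(2)] D[rule_format, OF l(2)] by auto
  have V0: "chain d (V 0) l = chain d W l"
    using \<open>l \<le> L\<close>
  proof (induction l)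
    case (Suc l)
    have "V 0 (Suc l) = W (Suc l)"
      using W[rule_format, of "Suc l"] D[rule_format, of "Suc l"] Suc.prems
      by (intro eq_matI) (auto simp: V_def)
    then show ?case using Suc by simp
  qed simp
  have "((\<lambda>t. \<Sum>k<d l. (W (Suc l) $$ (i,k) + t * D (Suc l) $$ (i,k)) * chain d (V t) l $$ (k,j))
      has_real_derivative (\<Sum>k<d l. D (Suc l) $$ (i,k) * chain d W l $$ (k,j)
        + W (Suc l) $$ (i,k) * chain_deriv d W D l $$ (k,j))) (at 0)"
    by (rule DERIV_sum, rule DERIV_cong[OF DERIV_mult])
      (auto intro!: derivative_eq_intros Suc.IH[folded V_def] simp: l V0[unfolded V_def] Suc.prems V_def)
  moreover have "chain d (V t) (Suc l) $$ (i,j)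
      = (\<Sum>k<d l. (W (Suc l) $$ (i,k) + t * D (Suc l) $$ (i,k)) * chain d (V t) l $$ (k,j))" for t
  proof -
    have "dim_row (V t (Suc l)) = d (Suc l)" "dim_col (V t (Suc l)) = d l"
      "\<And>k. k < d l \<Longrightarrow> V t (Suc l) $$ (i,k) = W (Suc l) $$ (i,k) + t * D (Suc l) $$ (i,k)"
      using Suc.prems WS by (simp_all add: V_def)
    then show ?thesis using Suc.prems dims(1,2) by (simp add: mat_mult_entry)
  qed
  moreover have "chain_deriv d W D (Suc l) $$ (i,j) = (\<Sum>k<d l. D (Suc l) $$ (i,k) * chain d W l $$ (k,j)
        + W (Suc l) $$ (i,k) * chain_deriv d W D l $$ (k,j))"
    using Suc.prems dims WS by (simp add: mat_mult_entry sum.distrib)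
  ultimately show ?case unfolding V_def by simp
qed (simp add: sum.distrib)

text \<open>The residual propagated backwards: \<open>residual L W Z l\<close> is \<open>(W\<^sub>L \<cdots> W\<^sub>l\<^sub>+\<^sub>1)\<^sup>T Z\<close>.\<close>

function residual :: "nat \<Rightarrow> (nat \<Rightarrow> real mat) \<Rightarrow> real mat \<Rightarrow> nat \<Rightarrow> real mat" where
  "residual L W Z l = (if l < L then transpose_mat (W (Suc l)) * residual L W Z (Suc l) else Z)"
  by auto
termination by (relation "Wellfounded.measure (\<lambda>(L,W,Z,l). L - l)") auto

declare residual.simps [simp del]

lemma residual_last [simp]: "residual L W Z L = Z"
  by (simp add: residual.simps)

lemma residual_step: "l < L \<Longrightarrow> residual L W Z l = transpose_mat (W (Suc l)) * residual L W Z (Suc l)"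
  by (subst residual.simps) simp

lemma residual_dim:
  assumes "\<forall>l\<in>{1..L}. W l \<in> carrier_mat (d l) (d (l - 1))" "Z \<in> carrier_mat (d L) n" "l \<le> L"
  shows "dim_row (residual L W Z l) = d l" "dim_col (residual L W Z l) = n"
  using assms(3)
proof (induction rule: inc_induct)
  case base
  { case 1 then show ?case using assms(2) by auto }
  { case 2 then show ?case using assms(2) by auto }
next
  case (step l)
  { case 1 then show ?case using assms(1)[rule_format, of "Suc l"] step by (simp add: residual_step) }
  { case 2 then show ?case using step by (simp add: residual_step) }
qed

text \<open>Backpropagation: in the product rule, the term with \<open>D (Suc l)\<close> is already
  paired with its gradient, and in the other term the adjoint of \<open>W (Suc l)\<close> turns the
  residual at \<open>Suc l\<close> into the one at \<open>l\<close>.\<close>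

lemma residual_chain_deriv:
  assumes W: "\<forall>l\<in>{1..L}. W l \<in> carrier_mat (d l) (d (l - 1))"
    and D: "\<forall>l\<in>{1..L}. D l \<in> carrier_mat (d l) (d (l - 1))"
    and Z: "Z \<in> carrier_mat (d L) (d 0)" and "l \<le> L"
  shows "mat_ip (residual L W Z l) (chain_deriv d W D l)
    = (\<Sum>k\<in>{1..l}. mat_ip (residual L W Z k * transpose_mat (chain d W (k - 1))) (D k))"
  using assms(4)
proof (induction l)
  case 0
  then show ?case using residual_dim[OF W Z, of 0] by (simp add: mat_ip_def)
next
  case (Suc l)
  have l: "l \<le> L" "Suc l \<in> {1..L}" using Suc.prems by auto
  have WS: "dim_row (W (Suc l)) = d (Suc l)" "dim_col (W (Suc l)) = d l"
    "dim_row (D (Suc l)) = d (Suc l)" "dim_col (D (Suc l)) = d l"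
    using W[rule_format, OF l(2)] D[rule_format, OF l(2)] by auto
  note dims = WS chain_dim[OF W l(1)] chain_deriv_dim[OF W l(1)] residual_dim[OF W Z Suc.prems]
  have "mat_ip (residual L W Z (Suc l)) (chain_deriv d W D (Suc l))
    = mat_ip (residual L W Z (Suc l)) (D (Suc l) * chain d W l)
      + mat_ip (residual L W Z (Suc l)) (W (Suc l) * chain_deriv d W D l)"
    using dims by (simp add: mat_ip_add_right)
  also have "mat_ip (residual L W Z (Suc l)) (D (Suc l) * chain d W l)
    = mat_ip (residual L W Z (Suc l) * transpose_mat (chain d W l)) (D (Suc l))"
    using dims by (intro mat_ip_mult_right) simp_all
  also have "mat_ip (residual L W Z (Suc l)) (W (Suc l) * chain_deriv d W D l)
    = mat_ip (residual L W Z l) (chain_deriv d W D l)"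
    using dims Suc.prems by (subst mat_ip_mult_left) (simp_all add: residual_step)
  finally show ?case using Suc.IH l(1) by simp
qed

text \<open>Half of the partial gradient with respect to \<open>W l\<close>; the common factor 2 is
  left out.\<close>

definition loss_grad :: "nat \<Rightarrow> (nat \<Rightarrow> nat) \<Rightarrow> real mat \<Rightarrow> (nat \<Rightarrow> real) \<Rightarrow> (nat \<Rightarrow> real mat) \<Rightarrow> nat \<Rightarrow> real mat" where
  "loss_grad L d Y lam W l =
    residual L W (chain d W L - Y) l * transpose_mat (chain d W (l - 1)) + lam l \<cdot>\<^sub>m W l"

lemma loss_grad_dim:
  assumes "\<forall>l\<in>{1..L}. W l \<in> carrier_mat (d l) (d (l - 1))" "l \<in> {1..L}"
  shows "dim_row (loss_grad L d Y lam W l) = d l" "dim_col (loss_grad L d Y lam W l) = d (l - 1)"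
  using assms(1)[rule_format, OF assms(2)] by (simp_all add: loss_grad_def)

lemma has_derivative_frob2:
  assumes "\<And>t. M t \<in> carrier_mat m n" "A \<in> carrier_mat m n" "M 0 = A"
    and "\<And>i j. i < m \<Longrightarrow> j < n \<Longrightarrow> ((\<lambda>t. M t $$ (i,j)) has_real_derivative E $$ (i,j)) (at 0)"
  shows "((\<lambda>t. frob2 (M t)) has_real_derivative 2 * mat_ip A E) (at 0)"
proof -
  have dM: "dim_row (M t) = m" "dim_col (M t) = n" for t using assms(1)[of t] by auto
  have "((\<lambda>t. \<Sum>i<m. \<Sum>j<n. (M t $$ (i,j))^2) has_real_derivative
     (\<Sum>i<m. \<Sum>j<n. 2 * (A $$ (i,j) * E $$ (i,j)))) (at 0)"
    by (auto intro!: derivative_eq_intros assms(4) DERIV_sum simp: assms(3))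
  then show ?thesis
    using assms(2) by (simp add: frob2_def dM mat_ip_def sum_distrib_left)
qed

lemma has_derivative_lossF:
  assumes W: "\<forall>l\<in>{1..L}. W l \<in> carrier_mat (d l) (d (l - 1))"
    and D: "\<forall>l\<in>{1..L}. D l \<in> carrier_mat (d l) (d (l - 1))"
    and Y: "Y \<in> carrier_mat (d L) (d 0)"
  shows "((\<lambda>t. lossF L d Y lam (\<lambda>l. W l + t \<cdot>\<^sub>m D l)) has_real_derivative
    2 * (\<Sum>l\<in>{1..L}. mat_ip (loss_grad L d Y lam W l) (D l))) (at 0)"
proof -
  define V where "V = (\<lambda>t l. W l + t \<cdot>\<^sub>m D l)"
  have V: "\<forall>l\<in>{1..L}. V t l \<in> carrier_mat (d l) (d (l - 1))" for t
    using W D by (simp add: V_def)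
  have V0: "V 0 l = W l" if "l \<in> {1..L}" for l
    using W[rule_format, OF that] D[rule_format, OF that] by (intro eq_matI) (auto simp: V_def)
  have "chain d (V 0) l = chain d W l" if "l \<le> L" for l
    using that by (induction l) (simp_all add: V0)
  then have C0: "chain d (V 0) L = chain d W L" by simp
  define Z where "Z = chain d W L - Y"
  have Z: "Z \<in> carrier_mat (d L) (d 0)" using Y by (auto simp: Z_def)
  have F1: "((\<lambda>t. frob2 (chain d (V t) L - Y)) has_real_derivative 2 * mat_ip Z (chain_deriv d W D L)) (at 0)"
  proof (rule has_derivative_frob2[OF _ Z])
    show "chain d (V t) L - Y \<in> carrier_mat (d L) (d 0)" for t using Y by auto
    show "chain d (V 0) L - Y = Z" by (simp add: C0 Z_def)
    show "((\<lambda>t. (chain d (V t) L - Y) $$ (i,j)) has_real_derivative chain_deriv d W D L $$ (i,j)) (at 0)"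
      if "i < d L" "j < d 0" for i j
      using that Y has_derivative_chain[OF W D _ that]
      by (auto simp: V_def intro!: derivative_eq_intros)
  qed
  have F2: "((\<lambda>t. frob2 (V t l)) has_real_derivative 2 * mat_ip (W l) (D l)) (at 0)"
    if "l \<in> {1..L}" for l
  proof (rule has_derivative_frob2)
    show "V t l \<in> carrier_mat (d l) (d (l - 1))" for t using V that by blast
    show "W l \<in> carrier_mat (d l) (d (l - 1))" "V 0 l = W l" using W V0 that by auto
    show "((\<lambda>t. V t l $$ (i,j)) has_real_derivative D l $$ (i,j)) (at 0)"
      if "i < d l" "j < d (l - 1)" for i j
      using that W[rule_format, OF \<open>l \<in> {1..L}\<close>] D[rule_format, OF \<open>l \<in> {1..L}\<close>]
      by (auto intro!: derivative_eq_intros simp: V_def)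
  qed
  have "((\<lambda>t. lossF L d Y lam (V t)) has_real_derivative
     2 * mat_ip Z (chain_deriv d W D L) + (\<Sum>l\<in>{1..L}. lam l * (2 * mat_ip (W l) (D l)))) (at 0)"
    unfolding lossF_def by (intro DERIV_add DERIV_sum DERIV_cmult F1 F2)
  moreover have "mat_ip (loss_grad L d Y lam W l) (D l)
    = mat_ip (residual L W Z l * transpose_mat (chain d W (l - 1))) (D l) + lam l * mat_ip (W l) (D l)"
    if "l \<in> {1..L}" for l
    using that residual_dim[OF W Z, of l] chain_dim[OF W, of "l - 1"] W[rule_format, OF that]
    unfolding loss_grad_def Z_def[symmetric]
    by (subst mat_ip_add_left) (auto simp: mat_ip_smult_left)
  ultimately show ?thesis
    using residual_chain_deriv[OF W D Z order.refl]
    by (simp add: V_def sum.distrib sum_distrib_left algebra_simps)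
qed

lemma critical_iff_loss_grad:
  assumes W: "\<forall>l\<in>{1..L}. W l \<in> carrier_mat (d l) (d (l - 1))"
    and Y: "Y \<in> carrier_mat (d L) (d 0)"
  shows "critical L d Y lam W \<longleftrightarrow> (\<forall>l\<in>{1..L}. loss_grad L d Y lam W l = 0\<^sub>m (d l) (d (l - 1)))"
proof
  assume crit: "critical L d Y lam W"
  show "\<forall>l\<in>{1..L}. loss_grad L d Y lam W l = 0\<^sub>m (d l) (d (l - 1))"
  proof
    fix m assume m: "m \<in> {1..L}"
    let ?G = "loss_grad L d Y lam W m"
    have G: "?G \<in> carrier_mat (d m) (d (m - 1))"
      using loss_grad_dim[OF W m] by auto
    \<comment> \<open>The gradient of layer \<open>m\<close> itself is the test direction, which
      makes the derivative twice the squared norm of \<open>?G\<close>.\<close>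
    define D where "D = (\<lambda>l. if l = m then ?G else 0\<^sub>m (d l) (d (l - 1)))"
    have D: "\<forall>l\<in>{1..L}. D l \<in> carrier_mat (d l) (d (l - 1))" using G by (auto simp: D_def)
    have z: "mat_ip (loss_grad L d Y lam W l) (D l) = 0" if "l \<in> {1..L}" "l \<noteq> m" for l
      using loss_grad_dim[OF W that(1)] that(2) by (simp add: mat_ip_def D_def)
    have "(\<Sum>l\<in>{1..L}. mat_ip (loss_grad L d Y lam W l) (D l)) = 0"
      using crit D DERIV_unique[OF has_derivative_lossF[OF W D Y]]
      by (fastforce simp: critical_def)
    also have "(\<Sum>l\<in>{1..L}. mat_ip (loss_grad L d Y lam W l) (D l)) = mat_ip ?G ?G"
      using m z by (subst sum.remove[of _ m]) (auto simp: D_def)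
    finally show "?G = 0\<^sub>m (d m) (d (m - 1))"
      using mat_ip_self_eq_0[of ?G] G by simp
  qed
next
  assume grad: "\<forall>l\<in>{1..L}. loss_grad L d Y lam W l = 0\<^sub>m (d l) (d (l - 1))"
  have "mat_ip (loss_grad L d Y lam W l) B = 0" if "l \<in> {1..L}" for l B
    using grad that by (simp add: mat_ip_def)
  then show "critical L d Y lam W"
    unfolding critical_def using has_derivative_lossF[OF W _ Y, of _ lam] by force
qed

section \<open>Products of factorized layers\<close>

lemma orth_sandwich_mult:
  assumes "orth_mat n Q" "dim_col A = dim_row X" "dim_col X = n" "dim_row Z = n" "dim_col Z = dim_row B"
  shows "(A * X * transpose_mat Q) * (Q * Z * B) = A * (X * Z) * B"
  using assms(2-) orth_matD(2,3)[OF assms(1)]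
  by (simp add: mat_assoc orth_mat_cancel(2)[OF assms(1)])

text \<open>Neighbouring layers share an orthogonal factor, which cancels and leaves a product of
  diagonal matrices. The hypothesis on \<open>g\<close> ensures that no narrow layer cuts off a
  nonzero entry.\<close>

lemma chain_factorization:
  assumes Q: "\<forall>l\<in>{1..Suc m}. orth_mat (d (l - 1)) (Q l)"
    and W: "\<forall>l\<in>{1..m}. W l = Q (Suc l) * diag_rect (d l) (d (l - 1)) (\<lambda>i. g i / sqrt (lam l)) * transpose_mat (Q l)"
    and g: "\<forall>l i. l \<le> m \<longrightarrow> d l \<le> i \<longrightarrow> g i = 0"
    and "l \<le> m"
  shows "chain d W l =
    Q (Suc l) * diag_rect (d l) (d 0) (\<lambda>i. g i ^ l / sqrt (\<Prod>k\<in>{1..l}. lam k)) * transpose_mat (Q 1)"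
  using assms(4)
proof (induction l)
  case 0
  have Q1: "orth_mat (d 0) (Q 1)" using Q[rule_format, of 1] by simp
  have "diag_rect (d 0) (d 0) (\<lambda>i. 1) = 1\<^sub>m (d 0)" by (intro eq_matI) auto
  then show ?case using orth_matD[OF Q1] by simp
next
  case (Suc l)
  have Ql: "orth_mat (d l) (Q (Suc l))" using Q[rule_format, of "Suc l"] Suc.prems by simp
  have dQ: "dim_col (Q (Suc (Suc l))) = d (Suc l)" "dim_col (Q 1) = d 0"
    using orth_matD(3)[OF Q[rule_format, of "Suc (Suc l)"]] orth_matD(3)[OF Q[rule_format, of 1]] Suc.prems
    by simp_all
  have "chain d W (Suc l) = Q (Suc (Suc l))
      * (diag_rect (d (Suc l)) (d l) (\<lambda>i. g i / sqrt (lam (Suc l)))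
         * diag_rect (d l) (d 0) (\<lambda>i. g i ^ l / sqrt (\<Prod>k\<in>{1..l}. lam k))) * transpose_mat (Q 1)"
    using W[rule_format, of "Suc l"] Suc dQ by (simp add: orth_sandwich_mult[OF Ql])
  also have "diag_rect (d (Suc l)) (d l) (\<lambda>i. g i / sqrt (lam (Suc l)))
         * diag_rect (d l) (d 0) (\<lambda>i. g i ^ l / sqrt (\<Prod>k\<in>{1..l}. lam k))
     = diag_rect (d (Suc l)) (d 0) (\<lambda>i. g i ^ Suc l / sqrt (\<Prod>k\<in>{1..Suc l}. lam k))"
    using g[rule_format, of l] Suc.prems by (subst diag_rect_mult) (auto simp: real_sqrt_mult algebra_simps)
  finally show ?case .
qed

lemma residual_factorization:
  assumes Q: "\<forall>l\<in>{1..Suc L}. orth_mat (d (l - 1)) (Q l)"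
    and W: "\<forall>l\<in>{1..L}. W l = Q (Suc l) * diag_rect (d l) (d (l - 1)) (\<lambda>i. g i / sqrt (lam l)) * transpose_mat (Q l)"
    and g: "\<forall>l i. l \<le> L \<longrightarrow> d l \<le> i \<longrightarrow> g i = 0"
    and "l \<le> L"
  shows "residual L W (Q (Suc L) * diag_rect (d L) (d 0) z * transpose_mat (Q 1)) l =
    Q (Suc l) * diag_rect (d l) (d 0) (\<lambda>i. g i ^ (L - l) / sqrt (\<Prod>k\<in>{Suc l..L}. lam k) * z i) * transpose_mat (Q 1)"
  using assms(4)
proof (induction rule: inc_induct)
  case base
  show ?case by simp
next
  case (step l)
  have Ql: "orth_mat (d (Suc l)) (Q (Suc (Suc l)))" using Q[rule_format, of "Suc (Suc l)"] step.hyps by simp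
  have dQ: "dim_row (Q (Suc l)) = d l" "dim_col (Q (Suc l)) = d l" "dim_col (Q 1) = d 0"
    using orth_matD(2,3)[OF Q[rule_format, of "Suc l"]] orth_matD(3)[OF Q[rule_format, of 1]] step.hyps
    by simp_all
  have WT: "transpose_mat (W (Suc l)) = Q (Suc l) * diag_rect (d l) (d (Suc l)) (\<lambda>i. g i / sqrt (lam (Suc l)))
      * transpose_mat (Q (Suc (Suc l)))"
    using W[rule_format, of "Suc l"] step.hyps dQ orth_matD(2,3)[OF Ql]
    by (simp add: mat_transpose_mult transpose_diag_rect mat_assoc)
  have "residual L W (Q (Suc L) * diag_rect (d L) (d 0) z * transpose_mat (Q 1)) l = Q (Suc l)
      * (diag_rect (d l) (d (Suc l)) (\<lambda>i. g i / sqrt (lam (Suc l)))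
         * diag_rect (d (Suc l)) (d 0) (\<lambda>i. g i ^ (L - Suc l) / sqrt (\<Prod>k\<in>{Suc (Suc l)..L}. lam k) * z i))
      * transpose_mat (Q 1)"
    using step dQ by (simp add: residual_step WT orth_sandwich_mult[OF Ql])
  also have "diag_rect (d l) (d (Suc l)) (\<lambda>i. g i / sqrt (lam (Suc l)))
         * diag_rect (d (Suc l)) (d 0) (\<lambda>i. g i ^ (L - Suc l) / sqrt (\<Prod>k\<in>{Suc (Suc l)..L}. lam k) * z i)
     = diag_rect (d l) (d 0) (\<lambda>i. g i ^ (L - l) / sqrt (\<Prod>k\<in>{Suc l..L}. lam k) * z i)"
  proof (subst diag_rect_mult)
    show "diag_rect (d l) (d 0) (\<lambda>i. g i / sqrt (lam (Suc l)) *
        (g i ^ (L - Suc l) / sqrt (\<Prod>k\<in>{Suc (Suc l)..L}. lam k) * z i))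
      = diag_rect (d l) (d 0) (\<lambda>i. g i ^ (L - l) / sqrt (\<Prod>k\<in>{Suc l..L}. lam k) * z i)"
    proof (rule diag_rect_cong)
      fix i
      have "(\<Prod>k\<in>{Suc l..L}. lam k) = lam (Suc l) * (\<Prod>k\<in>{Suc (Suc l)..L}. lam k)"
        using step.hyps by (subst prod.atLeast_Suc_atMost) auto
      moreover have "g i ^ (L - l) = g i * g i ^ (L - Suc l)"
        using step.hyps by (simp add: Suc_diff_Suc flip: power_Suc)
      ultimately show "g i / sqrt (lam (Suc l)) * (g i ^ (L - Suc l) / sqrt (\<Prod>k\<in>{Suc (Suc l)..L}. lam k) * z i)
        = g i ^ (L - l) / sqrt (\<Prod>k\<in>{Suc l..L}. lam k) * z i"
        by (simp add: real_sqrt_mult)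
    qed
  qed (use g[rule_format, of "Suc l"] step.hyps in auto)
  finally show ?case .
qed

lemma prod_lam_split:
  fixes lam :: "nat \<Rightarrow> real"
  assumes "l \<in> {1..L}"
  shows "(\<Prod>k\<in>{1..L}. lam k) = (\<Prod>k\<in>{1..l - 1}. lam k) * lam l * (\<Prod>k\<in>{Suc l..L}. lam k)"
proof -
  have "{1..L} = {1..l} \<union> {Suc l..L}" using assms by auto
  then have "(\<Prod>k\<in>{1..L}. lam k) = (\<Prod>k\<in>{1..l}. lam k) * (\<Prod>k\<in>{Suc l..L}. lam k)"
    by (simp only:) (rule prod.union_disjoint, auto)
  moreover have "(\<Prod>k\<in>{1..l}. lam k) = (\<Prod>k\<in>{1..l - 1}. lam k) * lam l"
    using assms by (cases l) auto
  ultimately show ?thesis by simp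
qed

text \<open>The layers and \<open>Y\<close> are diagonal in matching bases, so the gradient is too,
  and its diagonal entries are positive multiples of the left side of the scalar equation.
  \<open>Q 1\<close> and \<open>Q (Suc L)\<close> stand for the rotated bases \<open>VY\<close> and
  \<open>UY\<close>.\<close>

lemma loss_grad_factorization:
  assumes L: "L \<ge> 2" and lam: "\<forall>l\<in>{1..L}. lam l > 0"
    and Q: "\<forall>l\<in>{1..Suc L}. orth_mat (d (l - 1)) (Q l)"
    and W: "\<forall>l\<in>{1..L}. W l = Q (Suc l) * diag_rect (d l) (d (l - 1)) (\<lambda>i. g i / sqrt (lam l)) * transpose_mat (Q l)"
    and Y: "Y = Q (Suc L) * diag_rect (d L) (d 0) y * transpose_mat (Q 1)"
    and g: "\<forall>l i. l \<le> L \<longrightarrow> d l \<le> i \<longrightarrow> g i = 0"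
    and eq: "\<And>i. g i ^ (2 * L - 1) - sqrt (\<Prod>l\<in>{1..L}. lam l) * y i * g i ^ (L - 1)
                     + (\<Prod>l\<in>{1..L}. lam l) * g i = 0"
    and l: "l \<in> {1..L}"
  shows "loss_grad L d Y lam W l = 0\<^sub>m (d l) (d (l - 1))"
proof -
  have Ql: "orth_mat (d l) (Q (Suc l))" "orth_mat (d (l - 1)) (Q l)" "orth_mat (d 0) (Q 1)" "orth_mat (d L) (Q (Suc L))"
    using Q[rule_format, of "Suc l"] Q[rule_format, of l] Q[rule_format, of 1] Q[rule_format, of "Suc L"] l
    by simp_all
  note dQ = orth_matD(2,3)[OF Ql(1)] orth_matD(2,3)[OF Ql(2)] orth_matD(2,3)[OF Ql(3)] orth_matD(2,3)[OF Ql(4)]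
  let ?\<Lambda> = "\<Prod>k\<in>{1..L}. lam k"
  define z where "z = (\<lambda>i. g i ^ L / sqrt ?\<Lambda> - y i)"
  have "chain d W L - Y = Q (Suc L) * (diag_rect (d L) (d 0) (\<lambda>i. g i ^ L / sqrt ?\<Lambda>) * transpose_mat (Q 1))
     - Q (Suc L) * (diag_rect (d L) (d 0) y * transpose_mat (Q 1))"
    using chain_factorization[OF Q W g order.refl] dQ by (simp add: Y mat_assoc)
  also have "\<dots> = Q (Suc L) * (diag_rect (d L) (d 0) z * transpose_mat (Q 1))"
  proof -
    have "diag_rect (d L) (d 0) z = diag_rect (d L) (d 0) (\<lambda>i. g i ^ L / sqrt ?\<Lambda>) - diag_rect (d L) (d 0) y"
      by (intro eq_matI) (auto simp: z_def)
    then show ?thesis using dQ by (simp add: mat_mult_minus mat_minus_mult)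
  qed
  finally have Z: "chain d W L - Y = Q (Suc L) * diag_rect (d L) (d 0) z * transpose_mat (Q 1)"
    using dQ by (simp add: mat_assoc)
  \<comment> \<open>The weights above, below and at layer \<open>l\<close>: the residual contributes
    \<open>1/a\<close>, the partial product \<open>1/b\<close>, and \<open>a * b * c\<close> is the
    square root of the full product.\<close>
  define a b c where "a = sqrt (\<Prod>k\<in>{Suc l..L}. lam k)" and "b = sqrt (\<Prod>k\<in>{1..l - 1}. lam k)"
    and "c = sqrt (lam l)"
  have pos: "a > 0" "b > 0" "c > 0"
    using lam l by (auto simp: a_def b_def c_def intro!: prod_pos)
  have \<Lambda>: "sqrt ?\<Lambda> = a * b * c" "?\<Lambda> = (a * b * c) ^ 2" "lam l = c ^ 2"
  proof -
    show 1: "sqrt ?\<Lambda> = a * b * c"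
      unfolding a_def b_def c_def prod_lam_split[OF l] by (simp add: real_sqrt_mult)
    have "?\<Lambda> > 0" using lam by (intro prod_pos) auto
    then show "?\<Lambda> = (a * b * c) ^ 2" unfolding 1[symmetric] by simp
    show "lam l = c ^ 2" using lam l by (simp add: c_def less_imp_le)
  qed
  have diff_le: "l - 1 \<le> L" and lL: "l \<le> L" using l by auto
  have C: "transpose_mat (chain d W (l - 1)) =
      Q 1 * diag_rect (d 0) (d (l - 1)) (\<lambda>i. g i ^ (l - 1) / b) * transpose_mat (Q l)"
    using chain_factorization[OF Q W g diff_le] l dQ
    by (simp add: b_def mat_transpose_mult transpose_diag_rect mat_assoc)
  have "residual L W (chain d W L - Y) l * transpose_mat (chain d W (l - 1)) = Q (Suc l)
     * (diag_rect (d l) (d 0) (\<lambda>i. g i ^ (L - l) / a * z i)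
        * diag_rect (d 0) (d (l - 1)) (\<lambda>i. g i ^ (l - 1) / b)) * transpose_mat (Q l)"
    unfolding Z C residual_factorization[OF Q W g lL] a_def
    by (rule orth_sandwich_mult[OF Ql(3)]) (simp_all add: dQ)
  also have "diag_rect (d l) (d 0) (\<lambda>i. g i ^ (L - l) / a * z i)
        * diag_rect (d 0) (d (l - 1)) (\<lambda>i. g i ^ (l - 1) / b)
     = diag_rect (d l) (d (l - 1)) (\<lambda>i. (g i ^ (L - l) / a * z i) * (g i ^ (l - 1) / b))"
  proof (rule diag_rect_mult)
    fix i assume "d 0 \<le> i"
    \<comment> \<open>Since \<open>L \<ge> 2\<close>, at least one of the exponents
      \<open>L - l\<close> and \<open>l - 1\<close> is positive, so a zero of \<open>g\<close>
      survives although \<open>0 ^ 0 = 1\<close>.\<close>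
    then have "g i = 0" using g[rule_format, of 0 i] by simp
    then show "g i ^ (L - l) / a * z i * (g i ^ (l - 1) / b) = 0"
      using L l by (cases "l = L") auto
  qed
  also have "\<dots> = diag_rect (d l) (d (l - 1)) (\<lambda>i. - (c * g i))"
  proof (rule diag_rect_cong)
    fix i
    have gL: "g i ^ (L - l) * g i ^ (l - 1) = g i ^ (L - 1)"
      using l by (simp flip: power_add)
    have gL': "g i ^ (2 * L - 1) = g i ^ L * g i ^ (L - 1)"
    proof -
      have "2 * L - 1 = L + (L - 1)" using L by simp
      then show ?thesis by (simp only: power_add)
    qed
    have "(g i ^ (L - l) / a * z i) * (g i ^ (l - 1) / b) = g i ^ (L - 1) * z i / (a * b)"
      unfolding gL[symmetric] by simp
    also have "\<dots> = (g i ^ L * g i ^ (L - 1) - a * b * c * y i * g i ^ (L - 1)) / (a * b * c * (a * b))"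
      using pos unfolding z_def \<Lambda>(1) by (simp add: field_simps)
    also have "g i ^ L * g i ^ (L - 1) - a * b * c * y i * g i ^ (L - 1) = - ((a * b * c) ^ 2 * g i)"
      using eq[of i, unfolded gL', unfolded \<Lambda>(1), unfolded \<Lambda>(2)] by simp
    also have "- ((a * b * c) ^ 2 * g i) / (a * b * c * (a * b)) = - (c * g i)"
      using pos by (simp add: power2_eq_square)
    finally show "(g i ^ (L - l) / a * z i) * (g i ^ (l - 1) / b) = - (c * g i)" .
  qed
  finally have P: "residual L W (chain d W L - Y) l * transpose_mat (chain d W (l - 1))
    = Q (Suc l) * (diag_rect (d l) (d (l - 1)) (\<lambda>i. - (c * g i)) * transpose_mat (Q l))"
    using dQ by (simp add: mat_assoc)
  have "lam l \<cdot>\<^sub>m W l = Q (Suc l) * (diag_rect (d l) (d (l - 1)) (\<lambda>i. c * g i) * transpose_mat (Q l))"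
  proof -
    have "lam l \<cdot>\<^sub>m W l = Q (Suc l) * ((lam l \<cdot>\<^sub>m diag_rect (d l) (d (l - 1)) (\<lambda>i. g i / c)) * transpose_mat (Q l))"
      using W[rule_format, OF l] dQ by (simp add: c_def mat_assoc mat_mult_smult mat_smult_mult)
    then show ?thesis using pos by (simp add: smult_diag_rect \<Lambda>(3) power2_eq_square)
  qed
  moreover have "Q (Suc l) * (diag_rect (d l) (d (l - 1)) (\<lambda>i. - (c * g i)) * transpose_mat (Q l))
    = - 1 \<cdot>\<^sub>m (Q (Suc l) * (diag_rect (d l) (d (l - 1)) (\<lambda>i. c * g i) * transpose_mat (Q l)))"
  proof -
    have "diag_rect (d l) (d (l - 1)) (\<lambda>i. - (c * g i)) = - 1 \<cdot>\<^sub>m diag_rect (d l) (d (l - 1)) (\<lambda>i. c * g i)"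
      by (simp add: smult_diag_rect)
    then show ?thesis using dQ by (simp only: mat_smult_mult mat_mult_smult diag_rect_dim index_mult_mat index_transpose_mat)
  qed
  moreover have "- 1 \<cdot>\<^sub>m A + A = 0\<^sub>m (dim_row A) (dim_col A)" for A :: "real mat"
    by (intro eq_matI) auto
  ultimately show ?thesis
    unfolding loss_grad_def P using dQ by simp
qed

text \<open>Below \<open>r\<close> the claim reads \<open>y i * B_ji = B_ji * y j\<close>, which
  holds because \<open>B\<close> mixes only equal values. From \<open>r\<close> on \<open>y\<close>
  is 0, so \<open>P\<close> and \<open>R\<close> need not be related.\<close>

lemma diag_rect_intertwine:
  assumes B: "orth_mat r B" and P: "orth_mat (n - r) P" and R: "orth_mat (m - r) R"
    and r: "r \<le> m" "r \<le> n"
    and y0: "\<And>i. r \<le> i \<Longrightarrow> y i = 0"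
    and By: "\<And>i j. i < r \<Longrightarrow> j < r \<Longrightarrow> y i \<noteq> y j \<Longrightarrow> B $$ (i,j) = 0"
  shows "diag_rect m n y * transpose_mat (block2 B P) = block2 (transpose_mat B) R * diag_rect m n y"
proof (rule eq_matI)
  note dims = orth_matD(2,3)[OF B] orth_matD(2,3)[OF P] orth_matD(2,3)[OF R]
  fix i j assume "i < dim_row (block2 (transpose_mat B) R * diag_rect m n y)"
    "j < dim_col (block2 (transpose_mat B) R * diag_rect m n y)"
  then have ij: "i < m" "j < n" using dims r by auto
  then show "(diag_rect m n y * transpose_mat (block2 B P)) $$ (i,j)
      = (block2 (transpose_mat B) R * diag_rect m n y) $$ (i,j)"
    using dims r y0 By[of j i] by (cases "y i = y j")
      (auto simp: diag_rect_mult_entry mult_diag_rect_entry block2_entry not_less)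
qed (use assms orth_matD(2,3) in auto)

section \<open>Structure of critical points\<close>

text \<open>Each side is the product \<open>W_1^T ... W_L^T Z\<close>, split at a different
  layer.\<close>

lemma mult_transpose_residual:
  assumes W: "\<forall>l\<in>{1..L}. W l \<in> carrier_mat (d l) (d (l - 1))"
    and Z: "Z \<in> carrier_mat (d L) n" and "l \<le> L"
  shows "transpose_mat (chain d W l) * residual L W Z l = transpose_mat (chain d W L) * Z"
  using assms(3)
proof (induction rule: inc_induct)
  case (step l)
  have "Suc l \<le> L" "l \<le> L" using step.hyps by auto
  note dims = chain_dim[OF W this(2)] residual_dim[OF W Z this(1)]
  have "dim_row (W (Suc l)) = d (Suc l)" "dim_col (W (Suc l)) = d l"
    using W[rule_format, of "Suc l"] step.hyps by auto
  then have "transpose_mat (chain d W l) * residual L W Z l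
     = transpose_mat (chain d W (Suc l)) * residual L W Z (Suc l)"
    using dims step.hyps by (simp add: residual_step mat_transpose_mult mat_assoc)
  then show ?case using step.IH by simp
qed simp

lemma loss_grad_eq_0:
  assumes "\<forall>l\<in>{1..L}. W l \<in> carrier_mat (d l) (d (l - 1))" "l \<in> {1..L}"
    and "loss_grad L d Y lam W l = 0\<^sub>m (d l) (d (l - 1))" and "Y \<in> carrier_mat (d L) (d 0)"
  shows "residual L W (chain d W L - Y) l * transpose_mat (chain d W (l - 1)) = - lam l \<cdot>\<^sub>m W l"
proof (rule eq_matI)
  let ?P = "residual L W (chain d W L - Y) l * transpose_mat (chain d W (l - 1))"
  have Z: "chain d W L - Y \<in> carrier_mat (d L) (d 0)" using assms(4) by auto
  have dW: "dim_row (W l) = d l" "dim_col (W l) = d (l - 1)"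
    using assms(1)[rule_format, OF assms(2)] by auto
  have "?P + lam l \<cdot>\<^sub>m W l = 0\<^sub>m (d l) (d (l - 1))" using assms(3) by (simp add: loss_grad_def)
  then have e: "(?P + lam l \<cdot>\<^sub>m W l) $$ (i,j) = 0" if "i < d l" "j < d (l - 1)" for i j
    using that by simp
  show "dim_row ?P = dim_row (- lam l \<cdot>\<^sub>m W l)" "dim_col ?P = dim_col (- lam l \<cdot>\<^sub>m W l)"
    using dW residual_dim(1)[OF assms(1) Z, of l] chain_dim(1)[OF assms(1), of "l - 1"] assms(2) by auto
  show "?P $$ (i,j) = (- lam l \<cdot>\<^sub>m W l) $$ (i,j)"
    if "i < dim_row (- lam l \<cdot>\<^sub>m W l)" "j < dim_col (- lam l \<cdot>\<^sub>m W l)" for i j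
    using e[of i j] that dW by simp
qed

text \<open>Both \<open>B\<^sup>T S\<close> and \<open>S B\<^sup>T\<close> are symmetric, hence \<open>S\<^sup>T S\<close> commutes with \<open>B\<^sup>T B\<close> and with
  \<open>B\<^sup>T S\<close>: the Gram matrix \<open>X\<^sup>T X\<close> only mixes indices with equal singular values.\<close>

lemma gram_block_structure:
  assumes B: "B \<in> carrier_mat m n" and X: "X \<in> carrier_mat k n" and X': "X' \<in> carrier_mat m k'"
    and y: "\<forall>i\<ge>min m n. y i = 0" "\<And>i. y i \<ge> 0"
    and 1: "transpose_mat B * diag_rect m n y = transpose_mat X * X + transpose_mat B * B"
    and 2: "diag_rect m n y * transpose_mat B = X' * transpose_mat X' + B * transpose_mat B"
  shows "\<And>i j. i < n \<Longrightarrow> j < n \<Longrightarrow> y i \<noteq> y j \<Longrightarrow> (transpose_mat X * X) $$ (i,j) = 0"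
    and "\<And>i j. i < k \<Longrightarrow> j < n \<Longrightarrow> y j = 0 \<Longrightarrow> X $$ (i,j) = 0"
proof -
  \<comment> \<open>\<open>B\<close> is rectangular; padding it with zeros lets row and column
    indices be exchanged.\<close>
  define b where "b = (\<lambda>i j. if i < m \<and> j < n then B $$ (i,j) else 0)"
  have BS: "(transpose_mat B * diag_rect m n y) $$ (i,j) = b j i * y j" if "i < n" "j < n" for i j
    using that B y(1)[rule_format, of j] by (auto simp: mult_diag_rect_entry b_def)
  have SB: "(diag_rect m n y * transpose_mat B) $$ (i,j) = y i * b j i" if "i < m" "j < m" for i j
    using that B y(1)[rule_format, of i] by (auto simp: diag_rect_mult_entry b_def)
  have gram: "(transpose_mat A * A) $$ (i,j) = (\<Sum>l<dim_row A. A $$ (l,i) * A $$ (l,j))"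
    if "i < dim_col A" "j < dim_col A" for A :: "real mat" and i j
    using that by (simp add: mat_mult_entry)
  have gram': "(A * transpose_mat A) $$ (i,j) = (\<Sum>l<dim_col A. A $$ (i,l) * A $$ (j,l))"
    if "i < dim_row A" "j < dim_row A" for A :: "real mat" and i j
    using that by (simp add: mat_mult_entry)
  have e1: "b j i * y j = (\<Sum>l<k. X $$ (l,i) * X $$ (l,j)) + (\<Sum>l<m. B $$ (l,i) * B $$ (l,j))"
    if "i < n" "j < n" for i j
    using that B X BS[OF that] gram[of i X j] gram[of i B j] by (simp add: 1)
  have e2: "y i * b j i = (\<Sum>l<k'. X' $$ (i,l) * X' $$ (j,l)) + (\<Sum>l<n. B $$ (i,l) * B $$ (j,l))"
    if "i < m" "j < m" for i j
    using that B X' SB[OF that] gram'[of i X' j] gram'[of i B j] by (simp add: 2)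
  have sym1: "b j i * y j = b i j * y i" if "i < n" "j < n" for i j
    unfolding e1[OF that] e1[OF that(2,1)] by (simp add: mult.commute)
  have sym2: "y i * b j i = y j * b i j" if "i < m" "j < m" for i j
    unfolding e2[OF that] e2[OF that(2,1)] by (simp add: mult.commute)
  \<comment> \<open>If both symmetries apply, together they give
    \<open>b j i * (y j ^ 2 - y i ^ 2) = 0\<close>, and nonnegativity excludes
    \<open>y i = - y j\<close>. If an index leaves the square part, the corresponding singular value
    is 0, and one symmetry is enough.\<close>
  have b0: "b j i = 0" if "y i \<noteq> y j" for i j
  proof (cases "j < m \<and> i < n")
    case True
    show ?thesis
    proof (cases "i < m \<and> j < n")
      case ij: True
      have "b j i * (y j * y j) = (b i j * y i) * y j"
        using sym1[of i j] ij True by (simp add: mult.assoc)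
      also have "\<dots> = b j i * (y i * y i)"
        using sym2[of i j] ij True by (simp add: algebra_simps)
      finally have "b j i = 0 \<or> (y j - y i) * (y j + y i) = 0" by (auto simp: algebra_simps)
      then show ?thesis using that y(2)[of i] y(2)[of j] by auto
    next
      case False
      then consider "m \<le> i" "j < n" | "n \<le> j" "i < m" | "m \<le> i" "n \<le> j" by linarith
      then show ?thesis
      proof cases
        case 1
        then show ?thesis using sym1[of i j] y(1)[rule_format, of i] True that by simp
      next
        case 2
        then show ?thesis using sym2[of i j] y(1)[rule_format, of j] True that by simp
      next
        case 3
        then show ?thesis using y(1)[rule_format, of i] y(1)[rule_format, of j] that by simp
      qed
    qed
  qed (auto simp: b_def)
  show "(transpose_mat X * X) $$ (i,j) = 0" if "i < n" "j < n" "y i \<noteq> y j" for i j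
  proof -
    have "B $$ (l,i) * B $$ (l,j) = 0" if "l < m" for l
    proof (cases "y l = y i")
      case True
      then show ?thesis using b0[of j l] \<open>y i \<noteq> y j\<close> \<open>l < m\<close> \<open>j < n\<close> by (simp add: b_def)
    next
      case False
      then show ?thesis using b0[of i l] \<open>l < m\<close> \<open>i < n\<close> by (simp add: b_def)
    qed
    then have "(\<Sum>l<m. B $$ (l,i) * B $$ (l,j)) = 0" by (simp add: sum.neutral)
    then show ?thesis using e1[of i j] b0[of i j] that X gram[of i X j] by simp
  qed
  \<comment> \<open>For \<open>y j = 0\<close> the diagonal entry of the first identity is 0 on the
    left and a sum of two squared column norms on the right.\<close>
  show "X $$ (i,j) = 0" if "i < k" "j < n" "y j = 0" for i j
  proof -
    have "(\<Sum>l<k. X $$ (l,j) * X $$ (l,j)) + (\<Sum>l<m. B $$ (l,j) * B $$ (l,j)) = 0"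
      using e1[of j j] that by simp
    moreover have "(\<Sum>l<m. B $$ (l,j) * B $$ (l,j)) \<ge> 0" "(\<Sum>l<k. X $$ (l,j) * X $$ (l,j)) \<ge> 0"
      by (auto intro!: sum_nonneg)
    ultimately have "(\<Sum>l<k. X $$ (l,j) * X $$ (l,j)) = 0" by linarith
    then have "\<forall>l\<in>{..<k}. X $$ (l,j) * X $$ (l,j) = 0" by (subst (asm) sum_nonneg_eq_0_iff) auto
    then show ?thesis using that by simp
  qed
qed

text \<open>The eigenvalues of a Gram matrix are nonnegative, so their square roots exist;
  \<open>g\<close> is the future \<open>\<sigma>\<close>. The columns of \<open>X\<close> from
  \<open>s p\<close> on vanish, so the Gram matrix has a zero last block and needs no rotation
  there.\<close>

lemma block_gram_diagonalization:
  assumes s: "s 0 = 0" "\<forall>k\<in>{1..p}. s (k - 1) < s k" and r: "s p \<le> n"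
    and X: "X \<in> carrier_mat m n"
    and off: "\<forall>i<s p. \<forall>j<s p. \<not> same_block s p i j \<longrightarrow> (transpose_mat X * X) $$ (i,j) = 0"
    and zero: "\<forall>i<m. \<forall>j<n. s p \<le> j \<longrightarrow> X $$ (i,j) = 0"
  shows "\<exists>Ob g. (\<forall>k\<in>{1..p}. orth_mat (s k - s (k - 1)) (Ob k)) \<and> (\<forall>i. g i \<ge> 0) \<and> (\<forall>i\<ge>s p. g i = 0) \<and>
    transpose_mat (X * transpose_mat (block2 (blkD (map Ob [1..<p + 1])) (1\<^sub>m (n - s p))))
    * (X * transpose_mat (block2 (blkD (map Ob [1..<p + 1])) (1\<^sub>m (n - s p))))
    = diag_rect n n (\<lambda>i. g i ^ 2)"
proof -
  define N where "N = transpose_mat X * X"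
  define q where "q = n - s p"
  have n: "n = s p + q" using r by (simp add: q_def)
  have N: "N \<in> carrier_mat n n" using X by (auto simp: N_def)
  have N0: "N $$ (i,j) = 0" if "i < n" "j < n" "s p \<le> i \<or> s p \<le> j" for i j
    using that X zero by (auto simp: N_def mat_mult_entry intro!: sum.neutral)
  define N1 where "N1 = mat (s p) (s p) (\<lambda>(i,j). N $$ (i,j))"
  have "mat q q (\<lambda>(i,j). N $$ (s p + i, s p + j)) = 0\<^sub>m q q"
    using N0 by (intro eq_matI) (auto simp: n)
  then have N2: "N = block2 N1 (0\<^sub>m q q)"
    using block2_split[of N "s p" q] N N0 unfolding N1_def n by auto
  have Nsym: "N $$ (i,j) = N $$ (j,i)" if "i < n" "j < n" for i j
    using that X by (simp add: N_def mat_mult_entry mult.commute)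
  have "transpose_mat N1 = N1"
    using r by (intro eq_matI) (auto simp: N1_def Nsym)
  then obtain Ob e where Ob: "\<forall>k\<in>{1..p}. orth_mat (s k - s (k - 1)) (Ob k)"
    and e: "blkD (map Ob [1..<p + 1]) * N1 * transpose_mat (blkD (map Ob [1..<p + 1])) = diag_rect (s p) (s p) e"
    using block_symmetric_diagonalization[OF s, of N1] off by (auto simp: N1_def N_def)
  let ?B = "blkD (map Ob [1..<p + 1])"
  have dB: "dim_row ?B = s p" "dim_col ?B = s p"
    using orth_matD(2,3)[OF blkD_orth[OF s Ob]] by simp_all
  have dN1: "dim_row N1 = s p" "dim_col N1 = s p" by (simp_all add: N1_def)
  define R where "R = block2 ?B (1\<^sub>m q)"
  have dR: "dim_row R = n" "dim_col R = n" using dB by (simp_all add: R_def n)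
  define f where "f = (\<lambda>i. if i < s p then e i else 0)"
  have XR: "transpose_mat (X * transpose_mat R) * (X * transpose_mat R) = diag_rect n n f"
  proof -
    have "transpose_mat (X * transpose_mat R) * (X * transpose_mat R) = R * N * transpose_mat R"
      using X dR by (simp add: N_def mat_transpose_mult mat_assoc)
    also have "\<dots> = block2 (?B * N1 * transpose_mat ?B) (0\<^sub>m q q)"
      unfolding N2 R_def using dB dN1 by (simp add: block2_mult block2_transpose)
    also have "0\<^sub>m q q = diag_rect q q (\<lambda>_. 0)" by (intro eq_matI) auto
    finally show ?thesis unfolding e block2_diag_rect f_def n .
  qed
  have f: "f i \<ge> 0" for i
  proof (cases "i < n")
    case True
    have "f i = (transpose_mat (X * transpose_mat R) * (X * transpose_mat R)) $$ (i,i)"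
      using True by (simp add: XR)
    also have "\<dots> = (\<Sum>l<m. (X * transpose_mat R) $$ (l,i) * (X * transpose_mat R) $$ (l,i))"
      using True X dR by (simp add: mat_mult_entry[of i "transpose_mat (X * transpose_mat R)"])
    also have "\<dots> \<ge> 0" by (auto intro!: sum_nonneg)
    finally show ?thesis .
  qed (use r in \<open>simp add: f_def\<close>)
  have "diag_rect n n f = diag_rect n n (\<lambda>i. sqrt (f i) ^ 2)" using f by simp
  then show ?thesis
    using XR Ob f unfolding R_def q_def
    by (intro exI[of _ Ob] exI[of _ "\<lambda>i. sqrt (f i)"]) (auto simp: f_def)
qed

text \<open>A counting argument: the values \<open>v (s k)\<close> are positive and strictly
  decreasing, hence \<open>p\<close> different positive values. As \<open>p\<close> counts all of
  them, no positive value is left beyond \<open>s p\<close>, and different blocks carry different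
  values.\<close>

lemma singular_value_blocks:
  fixes v :: "nat \<Rightarrow> real"
  assumes mono: "\<forall>i j. 1 \<le> i \<and> i \<le> j \<longrightarrow> v j \<le> v i"
    and nn: "\<And>j. v j \<ge> 0" and out: "\<forall>j>D. v j = 0"
    and p: "p = card {x. x > 0 \<and> (\<exists>j\<in>{1..D}. v j = x)}"
    and s0: "s 0 = 0" and smono: "\<forall>k\<in>{1..p}. s (k - 1) < s k"
    and sblock: "\<forall>k\<in>{1..p}. (\<forall>j. s (k - 1) < j \<and> j \<le> s k \<longrightarrow> v j = v (s k)) \<and> v (s k) > v (s k + 1)"
  shows "s p \<le> D" and "\<And>j. s p < j \<Longrightarrow> v j = 0"
    and "\<And>i j. i < s p \<Longrightarrow> j < s p \<Longrightarrow> same_block s p i j \<longleftrightarrow> v (Suc i) = v (Suc j)"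
proof -
  have sm: "s j \<le> s k" if "j \<le> k" "k \<le> p" for j k
    using block_bounds_mono[OF smono that] .
  have pos: "v (s k) > 0" if "k \<in> {1..p}" for k
    using sblock that nn[of "s k + 1"] by fastforce
  have less: "v (s k) < v (s j)" if "j \<in> {1..p}" "k \<in> {1..p}" "j < k" for j k
  proof -
    have "s j \<le> s (k - 1)" using sm[of j "k - 1"] that by auto
    then have "s j + 1 \<le> s k" using smono[rule_format, OF that(2)] by simp
    then have "v (s k) \<le> v (s j + 1)" using mono by simp
    then show ?thesis using sblock that(1) by force
  qed
  show "s p \<le> D"
  proof (cases "p = 0")
    case False
    then show ?thesis using pos[of p] out[rule_format, of "s p"] by force
  qed (simp add: s0)
  then have sD: "s k \<in> {1..D}" if "k \<in> {1..p}" for k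
    using sm[of k p] smono[rule_format, OF that] that by auto
  let ?T = "{x. x > 0 \<and> (\<exists>j\<in>{1..D}. v j = x)}"
  have finT: "finite ?T" by (rule finite_subset[of _ "v ` {1..D}"]) auto
  have "inj_on (\<lambda>k. v (s k)) {1..p}"
    by (rule inj_onI) (metis less linorder_less_linear order_less_irrefl)
  then have "card ((\<lambda>k. v (s k)) ` {1..p}) = card ?T" by (simp add: card_image p)
  moreover have "(\<lambda>k. v (s k)) ` {1..p} \<subseteq> ?T" using pos sD by blast
  ultimately have T: "(\<lambda>k. v (s k)) ` {1..p} = ?T" using card_subset_eq[OF finT] by blast
  show "v j = 0" if j: "s p < j" for j
  proof (rule ccontr)
    assume "v j \<noteq> 0"
    then have "v j > 0" "j \<le> D" using nn[of j] out[rule_format, of j] by (auto simp: not_less[symmetric])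
    then have "v j \<in> ?T" using j by auto
    then obtain k where k: "k \<in> {1..p}" "v j = v (s k)" using T by blast
    then have "v (s p) \<le> v (s k)" using mono[rule_format, of "s k" "s p"] sm[of k p] sD[of k] by auto
    moreover have "v j \<le> v (s p + 1)" using mono j by simp
    moreover have "v (s p + 1) < v (s p)" using sblock k(1) by auto
    ultimately show False using k(2) by simp
  qed
  show "same_block s p i j \<longleftrightarrow> v (Suc i) = v (Suc j)" if ij: "i < s p" "j < s p" for i j
  proof -
    have ex: "\<exists>k\<in>{1..p}. s (k - 1) \<le> i \<and> i < s k" if "i < s p" for i
    proof -
      \<comment> \<open>The first bound above \<open>i\<close> closes the block that contains
        \<open>i\<close>; it is not \<open>s 0 = 0\<close>.\<close>
      define k where "k = (LEAST k. i < s k)"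
      have k: "i < s k" "k \<le> p" unfolding k_def using that by (auto intro: LeastI Least_le)
      then have "k \<noteq> 0" using s0 by (metis not_less0)
      then have "\<not> i < s (k - 1)" using not_less_Least[of "k - 1" "\<lambda>k. i < s k"]
        by (simp add: k_def[symmetric])
      then show ?thesis using k \<open>k \<noteq> 0\<close> by (intro bexI[of _ k]) auto
    qed
    obtain k where k: "k \<in> {1..p}" "s (k - 1) \<le> i" "i < s k" using ex[OF ij(1)] by blast
    obtain k' where k': "k' \<in> {1..p}" "s (k' - 1) \<le> j" "j < s k'" using ex[OF ij(2)] by blast
    have const: "v (Suc i) = v (s k)" if "k \<in> {1..p}" "s (k - 1) \<le> i" "i < s k" for i k
      using sblock[rule_format, OF that(1)] that(2,3) by (meson Suc_leI le_imp_less_Suc)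
    show ?thesis
    proof
      assume "same_block s p i j"
      then show "v (Suc i) = v (Suc j)" unfolding same_block_def using const by metis
    next
      assume "v (Suc i) = v (Suc j)"
      then have "v (s k) = v (s k')" using const k k' by metis
      then have "k = k'" using less k(1) k'(1) by (metis linorder_less_linear order_less_irrefl)
      then show "same_block s p i j" using k k' by (auto simp: same_block_def)
    qed
  qed
qed

text \<open>The invariant carries the Gram matrix of the first layer not yet factorized. It makes
  the columns of \<open>W m * Q m\<close> orthogonal, so completion gives \<open>Q (Suc m)\<close>;
  balancedness then passes the same diagonal on to layer \<open>Suc m\<close>. At
  \<open>m = L\<close> the last layer stays unfactorized, because its left basis must come from
  \<open>Y\<close>.\<close>

lemma layer_factorization:
  assumes W: "\<forall>l\<in>{1..L}. W l \<in> carrier_mat (d l) (d (l - 1))"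
    and lam: "\<forall>l\<in>{1..L}. lam l > 0"
    and Q1: "orth_mat (d 0) Q1"
    and g: "\<forall>l i. l \<le> L \<longrightarrow> d l \<le> i \<longrightarrow> g i = 0"
    and balanced: "\<forall>l\<in>{1..<L}.
      lam (Suc l) \<cdot>\<^sub>m (transpose_mat (W (Suc l)) * W (Suc l)) = lam l \<cdot>\<^sub>m (W l * transpose_mat (W l))"
    and gram: "lam 1 \<cdot>\<^sub>m (transpose_mat (W 1 * Q1) * (W 1 * Q1)) = diag_rect (d 0) (d 0) (\<lambda>i. g i ^ 2)"
    and "1 \<le> m" "m \<le> L"
  shows "\<exists>Q. Q 1 = Q1 \<and> (\<forall>l\<in>{1..m}. orth_mat (d (l - 1)) (Q l)) \<and>
    (\<forall>l\<in>{1..<m}. W l = Q (Suc l) * diag_rect (d l) (d (l - 1)) (\<lambda>i. g i / sqrt (lam l)) * transpose_mat (Q l)) \<and>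
    lam m \<cdot>\<^sub>m (transpose_mat (W m * Q m) * (W m * Q m)) = diag_rect (d (m - 1)) (d (m - 1)) (\<lambda>i. g i ^ 2)"
  using assms(7,8)
proof (induction rule: dec_induct)
  case base
  show ?case using Q1 gram by (intro exI[of _ "\<lambda>_. Q1"]) auto
next
  case (step m)
  have m: "m \<in> {1..L}" "Suc m \<in> {1..L}" "1 \<le> m" "m < L" using step by auto
  obtain Q where Q: "Q 1 = Q1" "\<forall>l\<in>{1..m}. orth_mat (d (l - 1)) (Q l)"
    "\<forall>l\<in>{1..<m}. W l = Q (Suc l) * diag_rect (d l) (d (l - 1)) (\<lambda>i. g i / sqrt (lam l)) * transpose_mat (Q l)"
    and gm: "lam m \<cdot>\<^sub>m (transpose_mat (W m * Q m) * (W m * Q m)) = diag_rect (d (m - 1)) (d (m - 1)) (\<lambda>i. g i ^ 2)"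
    using step.IH m by auto
  have Qm: "orth_mat (d (m - 1)) (Q m)" using Q(2) m by auto
  have dW: "dim_row (W m) = d m" "dim_col (W m) = d (m - 1)"
    "dim_row (W (Suc m)) = d (Suc m)" "dim_col (W (Suc m)) = d m"
    using W[rule_format, OF m(1)] W[rule_format, OF m(2)] by auto
  note dQ = orth_matD(2,3)[OF Qm]
  define c where "c = sqrt (lam m)"
  have c: "c > 0" "lam m = c * c" using lam m by (auto simp: c_def less_imp_le)
  define X where "X = c \<cdot>\<^sub>m (W m * Q m)"
  have X: "X \<in> carrier_mat (d m) (d (m - 1))" using dW dQ by (auto simp: X_def)
  have "transpose_mat X * X = diag_rect (d (m - 1)) (d (m - 1)) (\<lambda>i. g i ^ 2)"
    unfolding gm[symmetric] X_def c(2) using dW dQ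
    by (simp add: mat_transpose_smult mat_smult_mult mat_mult_smult mat_smult_smult)
  then obtain R where R: "orth_mat (d m) R" and XR: "X = R * diag_rect (d m) (d (m - 1)) g"
    using orthogonal_columns[OF X, of g] g[rule_format, of m] m by auto
  note dR = orth_matD(2,3)[OF R]
  let ?D = "diag_rect (d m) (d (m - 1)) (\<lambda>i. g i / c)"
  have "W m * Q m = (1 / c) \<cdot>\<^sub>m X" using c by (simp add: X_def mat_smult_smult mat_one_smult)
  also have "\<dots> = R * ?D" unfolding XR using dR by (simp add: mat_mult_smult[symmetric] smult_diag_rect)
  finally have WQ: "W m * Q m = R * ?D" .
  have "W m = W m * (Q m * transpose_mat (Q m))"
    using W[rule_format, OF m(1)] orth_matD(4)[OF Qm] by simp
  then have Wm: "W m = R * ?D * transpose_mat (Q m)"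
    using dW dQ by (simp add: mat_assoc[symmetric] WQ)
  have "lam (Suc m) \<cdot>\<^sub>m (transpose_mat (W (Suc m) * R) * (W (Suc m) * R))
    = transpose_mat R * (lam (Suc m) \<cdot>\<^sub>m (transpose_mat (W (Suc m)) * W (Suc m)) * R)"
    using dW dR by (simp add: mat_transpose_mult mat_assoc mat_smult_mult mat_mult_smult)
  also have "\<dots> = transpose_mat R * (lam m \<cdot>\<^sub>m (W m * transpose_mat (W m)) * R)"
    using balanced m(3,4) by simp
  also have "W m * transpose_mat (W m) = R * (?D * (transpose_mat ?D * transpose_mat R))"
    unfolding Wm using dR dQ by (simp add: mat_transpose_mult mat_assoc orth_mat_cancel(2)[OF Qm])
  also have "transpose_mat R * (lam m \<cdot>\<^sub>m (R * (?D * (transpose_mat ?D * transpose_mat R))) * R)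
    = lam m \<cdot>\<^sub>m (?D * transpose_mat ?D)"
    using dR orth_matD(5)[OF R]
    by (simp add: mat_assoc mat_smult_mult mat_mult_smult orth_mat_cancel(2)[OF R] right_mult_one_mat')
  also have "?D * transpose_mat ?D = diag_rect (d m) (d m) (\<lambda>i. (g i / c) * (g i / c))"
    unfolding transpose_diag_rect
    by (rule diag_rect_mult) (use g[rule_format, of "m - 1"] m in auto)
  also have "lam m \<cdot>\<^sub>m \<dots> = diag_rect (d m) (d m) (\<lambda>i. g i ^ 2)"
    using c by (simp add: smult_diag_rect power2_eq_square)
  finally have gram': "lam (Suc m) \<cdot>\<^sub>m (transpose_mat (W (Suc m) * R) * (W (Suc m) * R))
    = diag_rect (d m) (d m) (\<lambda>i. g i ^ 2)" .
  show ?case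
  proof (intro exI[of _ "Q(Suc m := R)"] conjI ballI)
    fix l
    show "orth_mat (d (l - 1)) ((Q(Suc m := R)) l)" if "l \<in> {1..Suc m}"
      using Q(2) R that by (cases "l = Suc m") auto
    show "W l = (Q(Suc m := R)) (Suc l) * diag_rect (d l) (d (l - 1)) (\<lambda>i. g i / sqrt (lam l))
      * transpose_mat ((Q(Suc m := R)) l)" if "l \<in> {1..<Suc m}"
      using Q(3) Wm that by (cases "l = m") (auto simp: c_def)
  qed (use Q(1) gram' m in auto)
qed

text \<open>Here \<open>C\<close> is the product of the layers before the last. In the bases
  \<open>P\<close> and \<open>Q\<close> the gradient equation decouples: entry \<open>(i,j)\<close>
  is multiplied by \<open>lam + t j ^ 2 > 0\<close>, so \<open>W\<close> is diagonal there with the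
  quotients \<open>x\<close> as entries.\<close>

lemma last_layer_factorization:
  assumes W: "W \<in> carrier_mat m n" and lam: "lam > 0"
    and P: "orth_mat m P" and Q: "orth_mat n Q" and R: "orth_mat k R"
    and C: "C = Q * diag_rect n k t * transpose_mat R"
    and Y: "Y = P * diag_rect m k y * transpose_mat R"
    and grad: "lam \<cdot>\<^sub>m W + W * (C * transpose_mat C) = Y * transpose_mat C"
    and gram: "lam \<cdot>\<^sub>m (transpose_mat (W * Q) * (W * Q)) = diag_rect n n (\<lambda>i. g i ^ 2)"
    and nn: "\<And>i. g i \<ge> 0" "\<And>i. y i \<ge> 0" "\<And>i. t i \<ge> 0"
    and t: "\<forall>i\<ge>k. t i = 0"
  shows "W = P * diag_rect m n (\<lambda>i. g i / sqrt lam) * transpose_mat Q"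
    and "\<And>i. i < m \<Longrightarrow> i < n \<Longrightarrow> g i * (lam + t i ^ 2) = sqrt lam * y i * t i"
proof -
  note dims = orth_matD(2,3)[OF P] orth_matD(2,3)[OF Q] orth_matD(2,3)[OF R]
  have dW: "dim_row W = m" "dim_col W = n" using W by auto
  define X where "X = transpose_mat P * (W * Q)"
  define x where "x = (\<lambda>i. y i * t i / (lam + t i ^ 2))"
  have pos: "lam + t i ^ 2 > 0" for i using lam by (simp add: add_pos_nonneg)
  have CC: "C * (transpose_mat C * Q) = Q * diag_rect n n (\<lambda>i. t i ^ 2)"
  proof -
    have "C * (transpose_mat C * Q) = Q * (diag_rect n k t * diag_rect k n t)"
      unfolding C using dims orth_matD(5)[OF Q]
      by (simp add: mat_transpose_mult mat_assoc transpose_diag_rect orth_mat_cancel(2)[OF R] right_mult_one_mat')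
    also have "diag_rect n k t * diag_rect k n t = diag_rect n n (\<lambda>i. t i ^ 2)"
      using t by (subst diag_rect_mult) (auto simp: power2_eq_square)
    finally show ?thesis .
  qed
  have YC: "transpose_mat P * (Y * (transpose_mat C * Q)) = diag_rect m n (\<lambda>i. y i * t i)"
  proof -
    have "transpose_mat P * (Y * (transpose_mat C * Q)) = diag_rect m k y * diag_rect k n t"
      unfolding C Y using dims orth_matD(5)[OF Q]
      by (simp add: mat_transpose_mult mat_assoc transpose_diag_rect orth_mat_cancel(2)[OF R]
          orth_mat_cancel(2)[OF P] right_mult_one_mat')
    also have "\<dots> = diag_rect m n (\<lambda>i. y i * t i)"
      using t by (intro diag_rect_mult) auto
    finally show ?thesis .
  qed
  have dC: "dim_row C = n" "dim_col C = k" "dim_row Y = m" "dim_col Y = k" using dims by (simp_all add: C Y)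
  have "lam \<cdot>\<^sub>m X + X * diag_rect n n (\<lambda>i. t i ^ 2)
    = transpose_mat P * ((lam \<cdot>\<^sub>m W + W * (C * transpose_mat C)) * Q)"
  proof -
    have "(lam \<cdot>\<^sub>m W + W * (C * transpose_mat C)) * Q = lam \<cdot>\<^sub>m (W * Q) + W * (C * (transpose_mat C * Q))"
      using dW dims dC by (subst add_mult_distrib_mat[of _ m n]) (auto simp: mat_assoc mat_smult_mult)
    also have "transpose_mat P * \<dots> = lam \<cdot>\<^sub>m X + transpose_mat P * (W * (C * (transpose_mat C * Q)))"
      using dW dims dC by (subst mult_add_distrib_mat[of _ m m _ n]) (auto simp: X_def mat_mult_smult)
    also have "transpose_mat P * (W * (C * (transpose_mat C * Q))) = X * diag_rect n n (\<lambda>i. t i ^ 2)"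
      unfolding CC X_def using dW dims by (simp add: mat_assoc)
    finally show ?thesis ..
  qed
  also have "\<dots> = diag_rect m n (\<lambda>i. y i * t i)"
    unfolding grad using YC dC dims by (simp add: mat_assoc)
  finally have eq: "lam \<cdot>\<^sub>m X + X * diag_rect n n (\<lambda>i. t i ^ 2) = diag_rect m n (\<lambda>i. y i * t i)" .
  have dX: "dim_row X = m" "dim_col X = n" using dW dims by (simp_all add: X_def)
  have "X $$ (i,j) * (lam + t j ^ 2) = (if i = j then y i * t i else 0)" if "i < m" "j < n" for i j
    using that dX arg_cong[OF eq, of "\<lambda>M. M $$ (i,j)"]
    by (simp add: mult_diag_rect_entry algebra_simps split: if_splits)
  then have "X $$ (i,j) = (if i = j then y i * t i else 0) / (lam + t j ^ 2)" if "i < m" "j < n" for i j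
    using that pos[of j] by (simp add: eq_divide_eq)
  then have Xx: "X = diag_rect m n x"
    using dX by (intro eq_matI) (auto simp: x_def)
  have "transpose_mat (W * Q) * (W * Q) = transpose_mat X * X"
    unfolding X_def using dW dims
    by (simp add: mat_transpose_mult mat_assoc orth_mat_cancel(1)[OF P])
  then have G: "lam \<cdot>\<^sub>m (transpose_mat X * X) = diag_rect n n (\<lambda>i. g i ^ 2)" using gram by simp
  have gx: "g i = sqrt lam * x i" if "i < m" "i < n" for i
  proof -
    have "lam * (x i * x i) = g i ^ 2"
      using that arg_cong[OF G, of "\<lambda>M. M $$ (i,i)"]
      by (simp add: Xx transpose_diag_rect diag_rect_mult_entry)
    moreover have "(sqrt lam * x i) ^ 2 = lam * (x i) ^ 2"
      using lam by (simp add: power_mult_distrib)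
    ultimately have "(sqrt lam * x i) ^ 2 = g i ^ 2" by (simp add: power2_eq_square)
    \<comment> \<open>The Gram matrix determines \<open>g\<close> only up to sign; nonnegativity of
      both sides settles it.\<close>
    moreover have "sqrt lam * x i \<ge> 0" using lam nn pos[of i] by (simp add: x_def)
    ultimately show ?thesis using nn(1)[of i] by (simp add: power2_eq_iff_nonneg)
  qed
  show "g i * (lam + t i ^ 2) = sqrt lam * y i * t i" if "i < m" "i < n" for i
    using gx[OF that] pos[of i] by (simp add: x_def)
  have "diag_rect m n x = diag_rect m n (\<lambda>i. g i / sqrt lam)"
    using gx lam by (intro diag_rect_cong) auto
  then have Xg: "X = diag_rect m n (\<lambda>i. g i / sqrt lam)" using Xx by simp
  have "W = P * (transpose_mat P * (W * Q)) * transpose_mat Q"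
    using dW dims orth_matD(4)[OF Q]
    by (simp add: orth_mat_cancel(1)[OF P]) (simp add: mat_assoc right_mult_one_mat')
  then show "W = P * diag_rect m n (\<lambda>i. g i / sqrt lam) * transpose_mat Q"
    using Xg by (simp only: X_def)
qed

text \<open>Multiplying the gradient equation of layer \<open>Suc l\<close> by
  \<open>W (Suc l)^T\<close> on the left and that of layer \<open>l\<close> by \<open>W l^T\<close>
  on the right gives the same data term, so the two regularization terms agree.\<close>

lemma critical_balanced:
  assumes W: "\<forall>l\<in>{1..L}. W l \<in> carrier_mat (d l) (d (l - 1))"
    and Y: "Y \<in> carrier_mat (d L) (d 0)"
    and grad: "\<forall>l\<in>{1..L}. loss_grad L d Y lam W l = 0\<^sub>m (d l) (d (l - 1))"
    and l: "l \<in> {1..<L}"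
  shows "lam (Suc l) \<cdot>\<^sub>m (transpose_mat (W (Suc l)) * W (Suc l)) = lam l \<cdot>\<^sub>m (W l * transpose_mat (W l))"
proof -
  let ?P = "residual L W (chain d W L - Y)"
  have Z: "chain d W L - Y \<in> carrier_mat (d L) (d 0)" using Y by auto
  have ls: "l \<in> {1..L}" "Suc l \<in> {1..L}" "l \<le> L" "l - 1 \<le> L" "Suc l \<le> L" using l by auto
  have dW: "dim_row (W l) = d l" "dim_col (W l) = d (l - 1)"
    "dim_row (W (Suc l)) = d (Suc l)" "dim_col (W (Suc l)) = d l"
    using W[rule_format, OF ls(1)] W[rule_format, OF ls(2)] by auto
  note dims = dW chain_dim[OF W ls(3)] chain_dim[OF W ls(4)] residual_dim[OF W Z ls(3)] residual_dim[OF W Z ls(5)]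
  have e: "?P l * transpose_mat (chain d W (l - 1)) = - lam l \<cdot>\<^sub>m W l"
    "?P (Suc l) * transpose_mat (chain d W l) = - lam (Suc l) \<cdot>\<^sub>m W (Suc l)"
    using loss_grad_eq_0[OF W ls(1) _ Y] loss_grad_eq_0[OF W ls(2) _ Y] grad ls by auto
  have chain: "chain d W l = W l * chain d W (l - 1)" using l by (cases l) auto
  have "- lam (Suc l) \<cdot>\<^sub>m (transpose_mat (W (Suc l)) * W (Suc l))
    = transpose_mat (W (Suc l)) * (?P (Suc l) * transpose_mat (chain d W l))"
    unfolding e(2) using dims by (simp add: mat_mult_smult)
  also have "\<dots> = ?P l * transpose_mat (chain d W l)"
    using dims l by (simp add: residual_step mat_assoc)
  also have "\<dots> = (?P l * transpose_mat (chain d W (l - 1))) * transpose_mat (W l)"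
    unfolding chain using dims by (simp add: mat_transpose_mult mat_assoc)
  also have "\<dots> = - lam l \<cdot>\<^sub>m (W l * transpose_mat (W l))"
    unfolding e(1) using dims by (simp add: mat_smult_mult)
  finally have "- 1 \<cdot>\<^sub>m (- lam (Suc l) \<cdot>\<^sub>m (transpose_mat (W (Suc l)) * W (Suc l)))
    = - 1 \<cdot>\<^sub>m (- lam l \<cdot>\<^sub>m (W l * transpose_mat (W l)))" by simp
  then show ?thesis by (simp add: mat_smult_smult mat_one_smult)
qed

text \<open>The first identity is the gradient equation of layer 1 multiplied by
  \<open>W 1^T\<close> on the left, the second that of layer \<open>L\<close> multiplied by
  \<open>W L^T\<close> on the right, and the third that of layer \<open>L\<close>
  rearranged.\<close>

lemma critical_chain_target:
  assumes L: "L \<ge> 1" and W: "\<forall>l\<in>{1..L}. W l \<in> carrier_mat (d l) (d (l - 1))"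
    and Y: "Y \<in> carrier_mat (d L) (d 0)"
    and grad: "\<forall>l\<in>{1..L}. loss_grad L d Y lam W l = 0\<^sub>m (d l) (d (l - 1))"
  defines "C \<equiv> chain d W L"
  shows "transpose_mat C * Y = lam 1 \<cdot>\<^sub>m (transpose_mat (W 1) * W 1) + transpose_mat C * C"
    and "Y * transpose_mat C = lam L \<cdot>\<^sub>m (W L * transpose_mat (W L)) + C * transpose_mat C"
    and "lam L \<cdot>\<^sub>m W L + W L * (chain d W (L - 1) * transpose_mat (chain d W (L - 1)))
      = Y * transpose_mat (chain d W (L - 1))"
proof -
  have Z: "C - Y \<in> carrier_mat (d L) (d 0)" using Y by auto
  have ls: "1 \<in> {1..L}" "L \<in> {1..L}" "L - 1 \<le> L" using L by auto
  have W1: "W 1 \<in> carrier_mat (d 1) (d 0)" using W[rule_format, OF ls(1)] by simp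
  have dW: "dim_row (W 1) = d 1" "dim_col (W 1) = d 0" "dim_row (W L) = d L" "dim_col (W L) = d (L - 1)"
    using W[rule_format, OF ls(1)] W[rule_format, OF ls(2)] by auto
  have dY: "dim_row Y = d L" "dim_col Y = d 0" using Y by auto
  have dC: "dim_row C = d L" "dim_col C = d 0" using chain_dim[OF W order.refl] by (simp_all add: C_def)
  note dims = dW dY dC chain_dim[OF W ls(3)]
  have chain: "C = W L * chain d W (L - 1)" unfolding C_def using L by (cases L) auto
  have e1: "residual L W (C - Y) 1 = - lam 1 \<cdot>\<^sub>m W 1"
    using loss_grad_eq_0[OF W ls(1) _ Y] grad ls residual_dim(2)[OF W Z L]
    by (simp add: C_def right_mult_one_mat')
  have e2: "(C - Y) * transpose_mat (chain d W (L - 1)) = - lam L \<cdot>\<^sub>m W L"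
    using loss_grad_eq_0[OF W ls(2) _ Y] grad ls by (simp add: C_def)
  have rearrange: "A = a \<cdot>\<^sub>m M + B" if "B - A = - a \<cdot>\<^sub>m M" "dim_row A = dim_row B" "dim_col A = dim_col B"
      "dim_row M = dim_row B" "dim_col M = dim_col B" for A B M :: "real mat" and a
  proof (rule eq_matI)
    fix i j assume "i < dim_row (a \<cdot>\<^sub>m M + B)" "j < dim_col (a \<cdot>\<^sub>m M + B)"
    then show "A $$ (i,j) = (a \<cdot>\<^sub>m M + B) $$ (i,j)"
      using that(2-) arg_cong[OF that(1), of "\<lambda>X. X $$ (i,j)"] by simp
  qed (use that in simp_all)
  have "transpose_mat C * C - transpose_mat C * Y = transpose_mat C * (C - Y)"
    using dims by (simp add: mat_mult_minus)
  also have "\<dots> = transpose_mat (chain d W 1) * residual L W (C - Y) 1"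
    using mult_transpose_residual[OF W Z L] by (simp add: C_def)
  also have "\<dots> = - lam 1 \<cdot>\<^sub>m (transpose_mat (W 1) * W 1)"
    unfolding e1 using W1 dims by (simp add: mat_mult_smult)
  finally show "transpose_mat C * Y = lam 1 \<cdot>\<^sub>m (transpose_mat (W 1) * W 1) + transpose_mat C * C"
    by (rule rearrange) (use dims in simp_all)
  have "C * transpose_mat C - Y * transpose_mat C = (C - Y) * transpose_mat C"
    using dims by (simp add: mat_minus_mult)
  also have "\<dots> = ((C - Y) * transpose_mat (chain d W (L - 1))) * transpose_mat (W L)"
    using dims by (subst (2) chain) (simp add: mat_transpose_mult mat_assoc)
  also have "\<dots> = - lam L \<cdot>\<^sub>m (W L * transpose_mat (W L))"
    unfolding e2 using dims by (simp add: mat_smult_mult)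
  finally show "Y * transpose_mat C = lam L \<cdot>\<^sub>m (W L * transpose_mat (W L)) + C * transpose_mat C"
    by (rule rearrange) (use dims in simp_all)
  have "C * transpose_mat (chain d W (L - 1)) - Y * transpose_mat (chain d W (L - 1)) = - lam L \<cdot>\<^sub>m W L"
    using e2 dims by (simp add: mat_minus_mult)
  then have "Y * transpose_mat (chain d W (L - 1)) = lam L \<cdot>\<^sub>m W L + C * transpose_mat (chain d W (L - 1))"
    by (rule rearrange) (use dims in simp_all)
  then show "lam L \<cdot>\<^sub>m W L + W L * (chain d W (L - 1) * transpose_mat (chain d W (L - 1)))
      = Y * transpose_mat (chain d W (L - 1))"
    using dims by (simp add: chain mat_assoc)
qed

text \<open>Multiply the diagonal equation of the last layer by \<open>P\<close>, which stands for
  the product of all weights but the last; \<open>P * lam\<close> is then the full product.\<close>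

lemma scalar_critical_equation:
  fixes x lam P v :: real
  assumes "L \<ge> 1" and P: "P > 0"
    and eq: "x * (lam + (x ^ (L - 1) / sqrt P) ^ 2) = sqrt lam * v * (x ^ (L - 1) / sqrt P)"
  shows "x ^ (2 * L - 1) - sqrt (P * lam) * v * x ^ (L - 1) + P * lam * x = 0"
proof -
  define u q where "u = x ^ (L - 1)" and "q = sqrt P"
  have q: "q > 0" "P = q ^ 2" using P by (simp_all add: q_def less_imp_le)
  have "2 * L - 1 = Suc ((L - 1) * 2)" using assms(1) by simp
  then have x: "x ^ (2 * L - 1) = x * u ^ 2" unfolding u_def by (simp only: power_Suc power_mult)
  have "x * (q ^ 2 * lam) + x * u ^ 2 = q ^ 2 * (x * (lam + (u / q) ^ 2))"
    using q(1) by (simp add: field_simps)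
  also have "\<dots> = q ^ 2 * (sqrt lam * v * (u / q))" using eq unfolding u_def q_def by simp
  also have "\<dots> = q * sqrt lam * v * u" using q(1) by (simp add: power2_eq_square)
  finally show ?thesis
    unfolding x real_sqrt_mult u_def[symmetric] q_def[symmetric] by (simp add: q(2) algebra_simps)
qed

section \<open>Critical points in terms of the singular value decomposition of
  \<open>Y\<close>\<close>

theorem theorem2p1:
  fixes L :: nat and d :: "nat \<Rightarrow> nat" and Y :: "real mat" and lam :: "nat \<Rightarrow> real"
    and UY VY SY :: "real mat" and r p :: nat and s :: "nat \<Rightarrow> nat"
    and W :: "nat \<Rightarrow> real mat"
  assumes L2: "L \<ge> 2"
    and dpos: "\<forall>l\<le>L. d l > 0"
    and Ydim: "Y \<in> carrier_mat (d L) (d 0)"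
    and lampos: "\<forall>l\<in>{1..L}. lam l > 0"
    and UY: "orth_mat (d L) UY" and VY: "orth_mat (d 0) VY"
    and SYdim: "SY \<in> carrier_mat (d L) (d 0)"
    and SYdiag: "\<forall>i<d L. \<forall>j<d 0. i \<noteq> j \<longrightarrow> SY $$ (i,j) = 0"
    and SYmono: "\<forall>i j. 1 \<le> i \<and> i \<le> j \<and> j \<le> min (d 0) (d L) \<longrightarrow> sv SY j \<le> sv SY i"
    and SYnn: "\<forall>j\<in>{1..min (d 0) (d L)}. sv SY j \<ge> 0"
    and svd: "Y = UY * SY * transpose_mat VY"
    and r_def: "r = vec_space.rank (d L) Y"
    and p_def: "p = card {v. v > 0 \<and> (\<exists>j\<in>{1..min (d 0) (d L)}. sv SY j = v)}"
    and s0: "s 0 = 0" and sp: "s p = r"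
    and smono: "\<forall>k\<in>{1..p}. s (k - 1) < s k"
    and sblock: "\<forall>k\<in>{1..p}. (\<forall>j. s (k - 1) < j \<and> j \<le> s k \<longrightarrow> sv SY j = sv SY (s k))
                              \<and> sv SY (s k) > sv SY (s k + 1)"
    and dmin: "\<forall>l\<in>{1..L - 1}. d l \<ge> min (d 0) (d L)"
    and Wdim: "\<forall>l\<in>{1..L}. W l \<in> carrier_mat (d l) (d (l - 1))"
  shows "critical L d Y lam W \<longleftrightarrow>
    (\<exists>Q Ob Op1 Ohat \<sigma>.
       (\<forall>l\<in>{2..L}. orth_mat (d (l - 1)) (Q l))
     \<and> (\<forall>i\<in>{1..p}. orth_mat (s i - s (i - 1)) (Ob i))
     \<and> orth_mat (d 0 - r) Op1
     \<and> orth_mat (d L - r) Ohat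
     \<and> (\<forall>i\<in>{1..r}. \<sigma> i ^ (2 * L - 1) - sqrt (\<Prod>l\<in>{1..L}. lam l) * sv SY i * \<sigma> i ^ (L - 1)
                     + (\<Prod>l\<in>{1..L}. lam l) * \<sigma> i = 0 \<and> \<sigma> i \<ge> 0)
     \<and> W 1 = Q 2 * sigmat (d 1) (d 0) r \<sigma> (sqrt (lam 1))
              * blkD (map Ob [1..<p + 1] @ [Op1]) * transpose_mat VY
     \<and> (\<forall>l\<in>{2..L - 1}. W l = Q (l + 1) * sigmat (d l) (d (l - 1)) r \<sigma> (sqrt (lam l))
                                * transpose_mat (Q l))
     \<and> W L = UY * blkD (map (\<lambda>i. transpose_mat (Ob i)) [1..<p + 1] @ [transpose_mat Ohat])
              * sigmat (d L) (d (L - 1)) r \<sigma> (sqrt (lam L)) * transpose_mat (Q L))"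
proof -
  \<comment> \<open>Singular values reindexed from 0 to match matrix entries; \<open>sv\<close>
    already extends them by 0.\<close>
  define y where "y = (\<lambda>i. sv SY (Suc i))"
  let ?\<Lambda> = "\<Prod>l\<in>{1..L}. lam l"
  have dSY: "dim_row SY = d L" "dim_col SY = d 0" using SYdim by auto
  have sv_nn: "sv SY j \<ge> 0" for j
    using SYnn dSY by (cases "j \<in> {1..min (d 0) (d L)}") (auto simp: sv_def)
  have sv_out: "\<forall>j>min (d 0) (d L). sv SY j = 0"
    using dSY by (auto simp: sv_def)
  have sv_mono: "\<forall>i j. 1 \<le> i \<and> i \<le> j \<longrightarrow> sv SY j \<le> sv SY i"
  proof (intro allI impI)
    fix i j :: nat assume "1 \<le> i \<and> i \<le> j"
    then show "sv SY j \<le> sv SY i"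
      using SYmono sv_nn[of i] sv_out by (cases "j \<le> min (d 0) (d L)") (auto simp: not_le)
  qed
  note blocks = singular_value_blocks[OF sv_mono sv_nn sv_out p_def s0 smono sblock, unfolded sp]
  have r: "r \<le> d 0" "r \<le> d L" using blocks(1) by auto
  \<comment> \<open>The width assumption enters here: every layer has room for all \<open>r\<close>
    values of \<open>\<sigma>\<close>.\<close>
  have rd: "r \<le> d l" if "l \<le> L" for l
  proof (cases "l = 0 \<or> l = L")
    case False
    then have "l \<in> {1..L - 1}" using that by auto
    then have "min (d 0) (d L) \<le> d l" using dmin by blast
    then show ?thesis using r by simp
  qed (use r in auto)
  have y0: "y i = 0" if "r \<le> i" for i using blocks(2)[of "Suc i"] that by (simp add: y_def)
  have y_nn: "y i \<ge> 0" for i by (simp add: y_def sv_nn)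
  have S: "SY = diag_rect (d L) (d 0) y"
    using SYdiag dSY by (intro eq_matI) (auto simp: y_def sv_def)
  have sig: "sigmat m n r \<sigma> c = diag_rect m n (\<lambda>i. (if i < r then \<sigma> (Suc i) else 0) / c)" for m n \<sigma> c
    by (intro eq_matI) (auto simp: sigmat_def)
  note dU = orth_matD(2,3)[OF UY] and dV = orth_matD(2,3)[OF VY]
  have blk_orth: "orth_mat r (blkD (map Ob [1..<p + 1]))"
    if "\<forall>i\<in>{1..p}. orth_mat (s i - s (i - 1)) (Ob i)" for Ob
    using blkD_orth[OF s0 smono that] by (simp only: sp)
  have blk_right: "blkD (map (\<lambda>i. transpose_mat (Ob i)) [1..<p + 1] @ [transpose_mat Oh])
      = block2 (transpose_mat (blkD (map Ob [1..<p + 1]))) (transpose_mat Oh)" for Ob Oh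
    by (simp only: blkD_snoc flip: blkD_transpose) (simp add: comp_def)
  \<comment> \<open>The rotated bases still give a singular value decomposition of \<open>Y\<close>.
    Both directions use this to put \<open>Y\<close> into the bases of the layers.\<close>
  have target: "Y = (UY * block2 (transpose_mat (blkD (map Ob [1..<p + 1]))) Oh) * diag_rect (d L) (d 0) y
      * transpose_mat (VY * transpose_mat (block2 (blkD (map Ob [1..<p + 1])) Op))"
    if Ob: "\<forall>i\<in>{1..p}. orth_mat (s i - s (i - 1)) (Ob i)"
      and Oh: "orth_mat (d L - r) Oh" and Op: "orth_mat (d 0 - r) Op" for Ob Oh Op
  proof -
    let ?B = "blkD (map Ob [1..<p + 1])"
    note B = blk_orth[OF Ob]
    have "?B $$ (i,j) = 0" if "i < r" "j < r" "y i \<noteq> y j" for i j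
      using blkD_entry_zero[OF s0 smono Ob, unfolded sp, OF that(1,2)] blocks(3)[OF that(1,2)] that(3)
      by (simp only: y_def not_False_eq_True)
    then have I: "diag_rect (d L) (d 0) y * transpose_mat (block2 ?B Op)
        = block2 (transpose_mat ?B) Oh * diag_rect (d L) (d 0) y"
      by (intro diag_rect_intertwine[OF B Op Oh r(2,1)] y0)
    have O: "orth_mat (d 0) (block2 ?B Op)" using block2_orth[OF B Op] r by simp
    have dims: "dim_row (block2 (transpose_mat ?B) Oh) = d L" "dim_col (block2 (transpose_mat ?B) Oh) = d L"
      using orth_matD(2,3)[OF B] orth_matD(2,3)[OF Oh] r by simp_all
    have "(UY * block2 (transpose_mat ?B) Oh) * diag_rect (d L) (d 0) y * transpose_mat (VY * transpose_mat (block2 ?B Op))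
      = UY * ((block2 (transpose_mat ?B) Oh * diag_rect (d L) (d 0) y) * block2 ?B Op * transpose_mat VY)"
      using dU dV dims orth_matD(2,3)[OF O] by (simp only: mat_transpose_mult mat_assoc
        transpose_transpose index_mult_mat index_transpose_mat diag_rect_dim)
    also have "\<dots> = UY * (diag_rect (d L) (d 0) y * (transpose_mat (block2 ?B Op) * block2 ?B Op) * transpose_mat VY)"
      using dU dV orth_matD(2,3)[OF O] by (simp only: I[symmetric] mat_assoc
        index_mult_mat index_transpose_mat diag_rect_dim)
    also have "\<dots> = Y"
      using dU dV unfolding orth_matD(5)[OF O] svd S[symmetric]
      by (simp add: dSY mat_assoc right_mult_one_mat')
    finally show ?thesis ..
  qed
  show ?thesis
  proof
    assume "critical L d Y lam W"
    then have grad: "\<forall>l\<in>{1..L}. loss_grad L d Y lam W l = 0\<^sub>m (d l) (d (l - 1))"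
      using critical_iff_loss_grad[OF Wdim Ydim] by blast
    have L1: "1 \<le> L" using L2 by simp
    have ls: "1 \<in> {1..L}" "L \<in> {1..L}" using L1 by auto
    have dW: "dim_row (W 1) = d 1" "dim_col (W 1) = d 0" "dim_row (W L) = d L" "dim_col (W L) = d (L - 1)"
      using Wdim[rule_format, OF ls(1)] Wdim[rule_format, OF ls(2)] by auto
    have lam_pos: "lam 1 > 0" "lam L > 0" using lampos ls by auto
    define C where "C = chain d W L"
    have dC: "dim_row C = d L" "dim_col C = d 0" using chain_dim[OF Wdim order.refl] by (simp_all add: C_def)
    note eqs = critical_chain_target[OF L1 Wdim Ydim grad, folded C_def]
    define B where "B = transpose_mat UY * (C * VY)"
    \<comment> \<open>The scaling makes \<open>X^T X\<close> equal to
      \<open>lam 1 * W_1^T W_1\<close> in the basis \<open>VY\<close>, and likewise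
      \<open>X' X'^T\<close> equal to \<open>lam L * W_L W_L^T\<close> in the basis
      \<open>UY\<close>.\<close>
    define X where "X = sqrt (lam 1) \<cdot>\<^sub>m (W 1 * VY)"
    define X' where "X' = sqrt (lam L) \<cdot>\<^sub>m (transpose_mat UY * W L)"
    have B: "B \<in> carrier_mat (d L) (d 0)" and X: "X \<in> carrier_mat (d 1) (d 0)"
      and X': "X' \<in> carrier_mat (d L) (d (L - 1))"
      using dU dV dC dW by (auto simp: B_def X_def X'_def)
    have XX: "transpose_mat X * X = transpose_mat VY * (lam 1 \<cdot>\<^sub>m (transpose_mat (W 1) * W 1) * VY)"
      using dV dW lam_pos by (simp add: X_def mat_transpose_smult mat_transpose_mult mat_smult_mult
          mat_mult_smult mat_smult_smult mat_assoc)
    have 1: "transpose_mat B * diag_rect (d L) (d 0) y = transpose_mat X * X + transpose_mat B * B"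
    proof -
      have "transpose_mat B * SY = transpose_mat VY * (transpose_mat C * Y) * VY"
        unfolding svd B_def using dU dV dC dSY orth_matD(5)[OF VY]
        by (simp add: mat_transpose_mult mat_assoc right_mult_one_mat')
      also have "\<dots> = transpose_mat VY * ((lam 1 \<cdot>\<^sub>m (transpose_mat (W 1) * W 1) * VY) + transpose_mat C * C * VY)"
        unfolding eqs(1) using dV dC dW
        by (subst add_mult_distrib_mat[symmetric, of _ "d 0" "d 0"]) (auto simp: mat_assoc)
      also have "\<dots> = transpose_mat X * X + transpose_mat VY * (transpose_mat C * C * VY)"
        unfolding XX using dV dC dW by (subst mult_add_distrib_mat[of _ "d 0" "d 0" _ "d 0"]) auto
      also have "transpose_mat VY * (transpose_mat C * C * VY) = transpose_mat B * B"
        using dU dV dC by (simp add: B_def mat_transpose_mult mat_assoc orth_mat_cancel(1)[OF UY])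
      finally show ?thesis by (simp only: S)
    qed
    have 2: "diag_rect (d L) (d 0) y * transpose_mat B = X' * transpose_mat X' + B * transpose_mat B"
    proof -
      have "SY * transpose_mat B = transpose_mat UY * (Y * transpose_mat C) * UY"
        unfolding svd B_def using dU dV dC dSY
        by (simp add: mat_transpose_mult mat_assoc orth_mat_cancel(2)[OF UY])
      also have "\<dots> = transpose_mat UY * ((lam L \<cdot>\<^sub>m (W L * transpose_mat (W L)) * UY) + C * transpose_mat C * UY)"
        unfolding eqs(2) using dU dC dW
        by (subst add_mult_distrib_mat[symmetric, of _ "d L" "d L"]) (auto simp: mat_assoc)
      also have "\<dots> = transpose_mat UY * (lam L \<cdot>\<^sub>m (W L * transpose_mat (W L)) * UY) + transpose_mat UY * (C * transpose_mat C * UY)"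
        using dU dC dW by (subst mult_add_distrib_mat[of _ "d L" "d L" _ "d L"]) auto
      also have "transpose_mat UY * (C * transpose_mat C * UY) = B * transpose_mat B"
        using dU dV dC by (simp add: B_def mat_transpose_mult mat_assoc orth_mat_cancel(1)[OF VY])
      also have "transpose_mat UY * (lam L \<cdot>\<^sub>m (W L * transpose_mat (W L)) * UY) = X' * transpose_mat X'"
        using dU dW lam_pos by (simp add: X'_def mat_transpose_smult mat_transpose_mult mat_smult_mult
            mat_mult_smult mat_smult_smult mat_assoc)
      finally show ?thesis by (simp only: S)
    qed
    have y_out: "\<forall>i\<ge>min (d L) (d 0). y i = 0"
    proof (intro allI impI)
      fix i assume "min (d L) (d 0) \<le> i"
      then show "y i = 0" using r by (intro y0) linarith
    qed
    note gram = gram_block_structure[OF B X X' y_out y_nn 1 2]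
    have off: "\<forall>i<s p. \<forall>j<s p. \<not> same_block s p i j \<longrightarrow> (transpose_mat X * X) $$ (i,j) = 0"
    proof (intro allI impI)
      fix i j assume "i < s p" "j < s p" "\<not> same_block s p i j"
      then show "(transpose_mat X * X) $$ (i,j) = 0"
        using gram(1)[of i j] blocks(3)[of i j] r by (simp add: sp y_def)
    qed
    have zero: "\<forall>i<d 1. \<forall>j<d 0. s p \<le> j \<longrightarrow> X $$ (i,j) = 0"
      using gram(2) y0 by (simp add: sp)
    obtain Ob g where Ob: "\<forall>k\<in>{1..p}. orth_mat (s k - s (k - 1)) (Ob k)"
      and g: "\<forall>i. g i \<ge> 0" "\<forall>i\<ge>r. g i = 0"
      and XR: "transpose_mat (X * transpose_mat (block2 (blkD (map Ob [1..<p + 1])) (1\<^sub>m (d 0 - r))))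
        * (X * transpose_mat (block2 (blkD (map Ob [1..<p + 1])) (1\<^sub>m (d 0 - r))))
        = diag_rect (d 0) (d 0) (\<lambda>i. g i ^ 2)"
      using block_gram_diagonalization[OF s0 smono _ X off zero] r(1) unfolding sp by blast
    let ?B = "blkD (map Ob [1..<p + 1])"
    define R where "R = block2 ?B (1\<^sub>m (d 0 - r))"
    define R' where "R' = block2 (transpose_mat ?B) (1\<^sub>m (d L - r))"
    have R: "orth_mat (d 0) R"
      using block2_orth[OF blk_orth[OF Ob] orth_mat_one[of "d 0 - r"]] r by (simp add: R_def)
    have R': "orth_mat (d L) R'"
      using block2_orth[OF orth_mat_transpose[OF blk_orth[OF Ob]] orth_mat_one[of "d L - r"]] r by (simp add: R'_def)
    \<comment> \<open>This acts as \<open>Q 1\<close>: its transpose is the factor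
      \<open>R VY^T\<close> required at the right end of \<open>W 1\<close>.\<close>
    define Q1 where "Q1 = VY * transpose_mat R"
    have Q1: "orth_mat (d 0) Q1" unfolding Q1_def by (intro orth_mat_mult orth_mat_transpose VY R)
    note dR = orth_matD(2,3)[OF R] orth_matD(2,3)[OF R'] orth_matD(2,3)[OF Q1]
    have gd: "\<forall>l i. l \<le> L \<longrightarrow> d l \<le> i \<longrightarrow> g i = 0" using g(2) rd by (meson order_trans)
    have "X * transpose_mat R = sqrt (lam 1) \<cdot>\<^sub>m (W 1 * Q1)"
      using dW dV dR by (simp add: X_def Q1_def mat_smult_mult mat_assoc)
    then have gram1: "lam 1 \<cdot>\<^sub>m (transpose_mat (W 1 * Q1) * (W 1 * Q1)) = diag_rect (d 0) (d 0) (\<lambda>i. g i ^ 2)"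
      using XR[folded R_def] dW dR lam_pos
      by (simp add: mat_transpose_smult mat_smult_mult mat_mult_smult mat_smult_smult)
    have balanced: "\<forall>l\<in>{1..<L}. lam (Suc l) \<cdot>\<^sub>m (transpose_mat (W (Suc l)) * W (Suc l))
      = lam l \<cdot>\<^sub>m (W l * transpose_mat (W l))"
      using critical_balanced[OF Wdim Ydim grad] by blast
    obtain Q where Q: "Q 1 = Q1" "\<forall>l\<in>{1..L}. orth_mat (d (l - 1)) (Q l)"
      and WQ: "\<forall>l\<in>{1..<L}. W l = Q (Suc l) * diag_rect (d l) (d (l - 1)) (\<lambda>i. g i / sqrt (lam l)) * transpose_mat (Q l)"
      and gramL: "lam L \<cdot>\<^sub>m (transpose_mat (W L * Q L) * (W L * Q L)) = diag_rect (d (L - 1)) (d (L - 1)) (\<lambda>i. g i ^ 2)"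
      using layer_factorization[OF Wdim lampos Q1 gd balanced gram1 L1 order.refl]
      by blast
    let ?\<Pi> = "\<Prod>l\<in>{1..L - 1}. lam l"
    define t where "t = (\<lambda>i. g i ^ (L - 1) / sqrt ?\<Pi>)"
    have \<Pi>: "?\<Pi> > 0" using lampos by (intro prod_pos) auto
    have \<Lambda>: "?\<Lambda> = ?\<Pi> * lam L" using L1 by (cases L) auto
    have QL: "orth_mat (d (L - 1)) (Q L)" using Q(2) ls by blast
    have P: "orth_mat (d L) (UY * R')" by (intro orth_mat_mult UY R')
    have CL: "chain d W (L - 1) = Q L * diag_rect (d (L - 1)) (d 0) t * transpose_mat Q1"
    proof -
      have L': "{1..L - 1} = {1..<L}" "Suc (L - 1) = L" using L1 by auto
      have "chain d W (L - 1) = Q (Suc (L - 1)) * diag_rect (d (L - 1)) (d 0) t * transpose_mat (Q 1)"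
        unfolding t_def
      proof (rule chain_factorization)
        show "\<forall>l\<in>{1..Suc (L - 1)}. orth_mat (d (l - 1)) (Q l)" unfolding L' by (rule Q(2))
        show "\<forall>l\<in>{1..L - 1}. W l = Q (Suc l) * diag_rect (d l) (d (l - 1)) (\<lambda>i. g i / sqrt (lam l))
          * transpose_mat (Q l)" unfolding L' by (rule WQ)
        show "\<forall>l i. l \<le> L - 1 \<longrightarrow> d l \<le> i \<longrightarrow> g i = 0"
          using gd by (meson diff_le_self order_trans)
      qed simp
      then show ?thesis unfolding L' Q(1) .
    qed
    have Yf: "Y = (UY * R') * diag_rect (d L) (d 0) y * transpose_mat Q1"
      unfolding R'_def Q1_def R_def by (rule target[OF Ob orth_mat_one orth_mat_one])
    have t_nn: "t i \<ge> 0" for i using g(1) \<Pi> by (simp add: t_def)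
    have t: "\<forall>i\<ge>d 0. t i = 0" using g(2) r L2 by (simp add: t_def)
    note last = last_layer_factorization[OF Wdim[rule_format, OF ls(2)] lam_pos(2) P QL Q1 CL Yf eqs(3) gramL
        g(1)[rule_format] y_nn t_nn t]
    define \<sigma> where "\<sigma> = (\<lambda>i. g (i - 1))"
    have sig_g: "sigmat m n r \<sigma> c = diag_rect m n (\<lambda>i. g i / c)" for m n c
      unfolding sig using g(2) by (intro diag_rect_cong) (auto simp: \<sigma>_def)
    have sol: "\<forall>i\<in>{1..r}. \<sigma> i ^ (2 * L - 1) - sqrt ?\<Lambda> * sv SY i * \<sigma> i ^ (L - 1) + ?\<Lambda> * \<sigma> i = 0 \<and> \<sigma> i \<ge> 0"
    proof
      fix i assume i: "i \<in> {1..r}"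
      define x where "x = g (i - 1)"
      have "i - 1 < d L" "i - 1 < d (L - 1)" using i r rd[of "L - 1"] by auto
      then have "x * (lam L + t (i - 1) ^ 2) = sqrt (lam L) * y (i - 1) * t (i - 1)"
        unfolding x_def by (rule last(2))
      moreover have "y (i - 1) = sv SY i" using i by (simp add: y_def)
      ultimately have "x * (lam L + (x ^ (L - 1) / sqrt ?\<Pi>) ^ 2) = sqrt (lam L) * sv SY i * (x ^ (L - 1) / sqrt ?\<Pi>)"
        by (simp only: t_def x_def)
      from scalar_critical_equation[OF L1 \<Pi> this]
      show "\<sigma> i ^ (2 * L - 1) - sqrt ?\<Lambda> * sv SY i * \<sigma> i ^ (L - 1) + ?\<Lambda> * \<sigma> i = 0 \<and> \<sigma> i \<ge> 0"
        unfolding \<Lambda> using g(1) by (simp only: \<sigma>_def x_def)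
    qed
    have first: "W 1 = Q 2 * sigmat (d 1) (d 0) r \<sigma> (sqrt (lam 1))
              * blkD (map Ob [1..<p + 1] @ [1\<^sub>m (d 0 - r)]) * transpose_mat VY"
    proof -
      have "W 1 = Q 2 * diag_rect (d 1) (d 0) (\<lambda>i. g i / sqrt (lam 1)) * transpose_mat Q1"
        using WQ[rule_format, of 1] L2 Q(1) by (simp add: numeral_2_eq_2)
      moreover have "orth_mat (d 1) (Q 2)" using Q(2)[rule_format, of 2] L2 by simp
      ultimately show ?thesis
        using dV dR orth_matD(2,3)[of "d 1" "Q 2"]
        by (simp only: sig_g blkD_snoc R_def[symmetric] Q1_def mat_transpose_mult transpose_transpose mat_assoc
            index_mult_mat index_transpose_mat diag_rect_dim)
    qed
    have middle: "\<forall>l\<in>{2..L - 1}. W l = Q (l + 1) * sigmat (d l) (d (l - 1)) r \<sigma> (sqrt (lam l)) * transpose_mat (Q l)"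
      using WQ by (auto simp: sig_g)
    have final: "W L = UY * blkD (map (\<lambda>i. transpose_mat (Ob i)) [1..<p + 1] @ [transpose_mat (1\<^sub>m (d L - r))])
              * sigmat (d L) (d (L - 1)) r \<sigma> (sqrt (lam L)) * transpose_mat (Q L)"
      unfolding blk_right unfolding transpose_one R'_def[symmetric] sig_g by (rule last(1))
    have orth: "\<forall>l\<in>{2..L}. orth_mat (d (l - 1)) (Q l)" using Q(2) by auto
    show "\<exists>Q Ob Op1 Ohat \<sigma>.
       (\<forall>l\<in>{2..L}. orth_mat (d (l - 1)) (Q l))
     \<and> (\<forall>i\<in>{1..p}. orth_mat (s i - s (i - 1)) (Ob i))
     \<and> orth_mat (d 0 - r) Op1
     \<and> orth_mat (d L - r) Ohat
     \<and> (\<forall>i\<in>{1..r}. \<sigma> i ^ (2 * L - 1) - sqrt (\<Prod>l\<in>{1..L}. lam l) * sv SY i * \<sigma> i ^ (L - 1)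
                     + (\<Prod>l\<in>{1..L}. lam l) * \<sigma> i = 0 \<and> \<sigma> i \<ge> 0)
     \<and> W 1 = Q 2 * sigmat (d 1) (d 0) r \<sigma> (sqrt (lam 1))
              * blkD (map Ob [1..<p + 1] @ [Op1]) * transpose_mat VY
     \<and> (\<forall>l\<in>{2..L - 1}. W l = Q (l + 1) * sigmat (d l) (d (l - 1)) r \<sigma> (sqrt (lam l))
                                * transpose_mat (Q l))
     \<and> W L = UY * blkD (map (\<lambda>i. transpose_mat (Ob i)) [1..<p + 1] @ [transpose_mat Ohat])
              * sigmat (d L) (d (L - 1)) r \<sigma> (sqrt (lam L)) * transpose_mat (Q L)"
      by (intro exI[of _ Q] exI[of _ Ob] exI[of _ "1\<^sub>m (d 0 - r)"] exI[of _ "1\<^sub>m (d L - r)"] exI[of _ \<sigma>] conjI)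
        (rule orth Ob orth_mat_one sol first middle final)+
  next
    assume "\<exists>Q Ob Op1 Ohat \<sigma>.
       (\<forall>l\<in>{2..L}. orth_mat (d (l - 1)) (Q l))
     \<and> (\<forall>i\<in>{1..p}. orth_mat (s i - s (i - 1)) (Ob i))
     \<and> orth_mat (d 0 - r) Op1
     \<and> orth_mat (d L - r) Ohat
     \<and> (\<forall>i\<in>{1..r}. \<sigma> i ^ (2 * L - 1) - sqrt (\<Prod>l\<in>{1..L}. lam l) * sv SY i * \<sigma> i ^ (L - 1)
                     + (\<Prod>l\<in>{1..L}. lam l) * \<sigma> i = 0 \<and> \<sigma> i \<ge> 0)
     \<and> W 1 = Q 2 * sigmat (d 1) (d 0) r \<sigma> (sqrt (lam 1))
              * blkD (map Ob [1..<p + 1] @ [Op1]) * transpose_mat VY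
     \<and> (\<forall>l\<in>{2..L - 1}. W l = Q (l + 1) * sigmat (d l) (d (l - 1)) r \<sigma> (sqrt (lam l))
                                * transpose_mat (Q l))
     \<and> W L = UY * blkD (map (\<lambda>i. transpose_mat (Ob i)) [1..<p + 1] @ [transpose_mat Ohat])
              * sigmat (d L) (d (L - 1)) r \<sigma> (sqrt (lam L)) * transpose_mat (Q L)"
    then obtain Q Ob Op1 Ohat \<sigma> where
      Q: "\<forall>l\<in>{2..L}. orth_mat (d (l - 1)) (Q l)"
      and Ob: "\<forall>i\<in>{1..p}. orth_mat (s i - s (i - 1)) (Ob i)"
      and Op1: "orth_mat (d 0 - r) Op1" and Ohat: "orth_mat (d L - r) Ohat"
      and \<sigma>: "\<forall>i\<in>{1..r}. \<sigma> i ^ (2 * L - 1) - sqrt (\<Prod>l\<in>{1..L}. lam l) * sv SY i * \<sigma> i ^ (L - 1)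
                     + (\<Prod>l\<in>{1..L}. lam l) * \<sigma> i = 0 \<and> \<sigma> i \<ge> 0"
      and W1: "W 1 = Q 2 * sigmat (d 1) (d 0) r \<sigma> (sqrt (lam 1))
              * blkD (map Ob [1..<p + 1] @ [Op1]) * transpose_mat VY"
      and Wl: "\<forall>l\<in>{2..L - 1}. W l = Q (l + 1) * sigmat (d l) (d (l - 1)) r \<sigma> (sqrt (lam l)) * transpose_mat (Q l)"
      and WL: "W L = UY * blkD (map (\<lambda>i. transpose_mat (Ob i)) [1..<p + 1] @ [transpose_mat Ohat])
              * sigmat (d L) (d (L - 1)) r \<sigma> (sqrt (lam L)) * transpose_mat (Q L)"
      by (elim exE conjE) (rule that)
    let ?B = "blkD (map Ob [1..<p + 1])"
    define R where "R = block2 ?B Op1"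
    define R' where "R' = block2 (transpose_mat ?B) (transpose_mat Ohat)"
    have R: "orth_mat (d 0) R" using block2_orth[OF blk_orth[OF Ob] Op1] r by (simp add: R_def)
    have R': "orth_mat (d L) R'"
      using block2_orth[OF orth_mat_transpose[OF blk_orth[OF Ob]] orth_mat_transpose[OF Ohat]] r by (simp add: R'_def)
    define g where "g = (\<lambda>i. if i < r then \<sigma> (Suc i) else 0)"
    \<comment> \<open>The outer rotations become orthogonal factors number 1 and
      \<open>Suc L\<close>, so that the first and the last layer get the same form as the
      others.\<close>
    define Q' where "Q' = (\<lambda>l. if l = 1 then VY * transpose_mat R else if l = Suc L then UY * R' else Q l)"
    have Q': "\<forall>l\<in>{1..Suc L}. orth_mat (d (l - 1)) (Q' l)"
    proof
      fix l assume "l \<in> {1..Suc L}"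
      then consider "l = 1" | "l = Suc L" | "l \<in> {2..L}" by fastforce
      then show "orth_mat (d (l - 1)) (Q' l)"
      proof cases
        case 1
        then show ?thesis by (simp add: Q'_def orth_mat_mult orth_mat_transpose VY R)
      next
        case 2
        then show ?thesis using L2 by (simp add: Q'_def orth_mat_mult UY R')
      next
        case 3
        then show ?thesis using Q by (simp add: Q'_def)
      qed
    qed
    have W': "\<forall>l\<in>{1..L}. W l = Q' (Suc l) * diag_rect (d l) (d (l - 1)) (\<lambda>i. g i / sqrt (lam l)) * transpose_mat (Q' l)"
    proof
      fix l assume "l \<in> {1..L}"
      then consider "l = 1" | "l = L" | "l \<in> {2..L - 1}" by fastforce
      then show "W l = Q' (Suc l) * diag_rect (d l) (d (l - 1)) (\<lambda>i. g i / sqrt (lam l)) * transpose_mat (Q' l)"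
      proof cases
        case 1
        have "Q' (Suc 1) = Q 2" "Q' 1 = VY * transpose_mat R" using L2 by (auto simp: Q'_def numeral_2_eq_2)
        moreover have "orth_mat (d 1) (Q 2)" using Q[rule_format, of 2] L2 by simp
        ultimately show ?thesis
          unfolding \<open>l = 1\<close> W1 sig blkD_snoc R_def[symmetric] g_def
          using dV orth_matD(2,3)[OF R] orth_matD(2,3)[of "d 1" "Q 2"]
          by (simp add: mat_transpose_mult mat_assoc)
      next
        case 2
        have "Q' (Suc L) = UY * R'" "Q' L = Q L" using L2 by (auto simp: Q'_def)
        then show ?thesis unfolding \<open>l = L\<close> WL sig blk_right R'_def[symmetric] g_def by simp
      next
        case 3
        then have "Q' (Suc l) = Q (l + 1)" "Q' l = Q l" by (auto simp: Q'_def)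
        then show ?thesis using Wl 3 unfolding sig g_def by auto
      qed
    qed
    have Y': "Y = Q' (Suc L) * diag_rect (d L) (d 0) y * transpose_mat (Q' 1)"
    proof -
      have "Q' (Suc L) = UY * R'" "Q' 1 = VY * transpose_mat R" using L2 by (auto simp: Q'_def)
      then show ?thesis
        using target[OF Ob orth_mat_transpose[OF Ohat] Op1] by (simp only: R'_def R_def)
    qed
    have gd: "\<forall>l i. l \<le> L \<longrightarrow> d l \<le> i \<longrightarrow> g i = 0" using rd by (fastforce simp: g_def)
    have eq: "g i ^ (2 * L - 1) - sqrt ?\<Lambda> * y i * g i ^ (L - 1) + ?\<Lambda> * g i = 0" for i
    proof (cases "i < r")
      case True
      then have "Suc i \<in> {1..r}" by simp
      moreover have "g i = \<sigma> (Suc i)" using True by (simp add: g_def)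
      ultimately show ?thesis using \<sigma> by (simp only: y_def)
    next
      case False
      \<comment> \<open>Positive exponents make every term vanish at \<open>g i = 0\<close>.\<close>
      moreover have "2 * L - 1 \<noteq> 0" "L - 1 \<noteq> 0" using L2 by auto
      ultimately show ?thesis by (simp add: g_def power_0_left)
    qed
    show "critical L d Y lam W"
      unfolding critical_iff_loss_grad[OF Wdim Ydim]
      using loss_grad_factorization[OF L2 lampos Q' W' Y' gd eq] by blast
  qed
qed

end
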